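(* Let $X$ be a locally compact Polish space with its Borel $\sigma$-algebra and a complete metric $d$ inducing its topology. Let $\lambda$ and $\rho$ be finite positive compactly supported Borel measures on $X$ with $\|\lambda\|=\|\rho\|$, and let $c:X\times X\to[0,\infty)$ be a continuous function such that $c(x,y)\le\alpha\, d(x,y)^p$ for all $x,y\in X$, for some constants $\alpha,p>0$. Then the optimal cost between the marginals $\lambda,\rho$ with respect to $c$ can be approximated arbitrarily well by costs of simple Markov transfunctions: for every $\varepsilon>0$ there is a simple Markov transfunction $\Phi:\mathcal{M}_{fr}(X)\to\mathcal{M}_{fr}(X)$ with $\Phi\lambda=\rho$ such that, if $\kappa\in\Pi(\lambda,\rho)$ is the plan corresponding to $\Phi$ on $\lambda$, then $$\left|\int_{X\times X}c\,d\kappa-\inf_{\pi\in\Pi(\lambda,\rho)}\int_{X\times X}c\,d\pi\right|<\varepsilon.$$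
   Context: $\|\cdot\|$ is the total variation norm. $\mathcal{M}_{fr}(X)$ is the space of all finite (hence regular) signed Borel measures on $X$, and $\mathcal{C}_b(X)$ is the space of bounded continuous real functions on $X$. $\Pi(\lambda,\rho)$ is the set of plans with marginals $\lambda$ and $\rho$, i.e. finite positive measures $\kappa$ on $X\times X$ with $\kappa(A\times X)=\lambda(A)$ and $\kappa(X\times B)=\rho(B)$ for all Borel $A,B\subseteq X$. A transfunction is a function $\Phi:\mathcal{M}_{fr}(X)\to\mathcal{M}_{fr}(X)$. It is simple if there are $f_1,\dots,f_m\in\mathcal{C}_b(X)$ and $\rho_1,\dots,\rho_m\in\mathcal{M}_{fr}(X)$ with $\Phi\sigma=\sum_{i=1}^m\left(\int_X f_i\,d\sigma\right)\rho_i$ for all $\sigma$. It is Markov if it is linear and continuous with respect to total variation, positive ($\sigma\ge0$ implies $\Phi\sigma\ge0$), and measure-preserving ($(\Phi\sigma)(X)=\sigma(X)$ for all $\sigma$). For a Markov transfunction $\Phi$ and a finite positive measure $\lambda$, the plan corresponding to $\Phi$ on $\lambda$ is the plan $\kappa\in\Pi(\lambda,\Phi\lambda)$ determined by $\kappa(A\times B)=\Phi(1_A\lambda)(B)$ for all Borel $A,B$, where $1_A\lambda$ is the measure $E\mapsto\lambda(A\cap E)$; the cost of $\Phi$ is $\int c\,d\kappa$. *)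

theory Defs
  imports "HOL-Analysis.Analysis"
begin

section \<open>Finite signed Borel measures\<close>

definition signed_borel :: "('a::topological_space set \<Rightarrow> real) \<Rightarrow> bool" where
  "signed_borel \<mu> \<longleftrightarrow>
     (\<forall>A :: nat \<Rightarrow> 'a set. range A \<subseteq> sets borel \<longrightarrow> disjoint_family A \<longrightarrow>
        (\<lambda>i. \<mu> (A i)) sums \<mu> (\<Union>i. A i)) \<and>
     (\<forall>A. A \<notin> sets borel \<longrightarrow> \<mu> A = 0)"

text \<open>Fixing the value \<open>0\<close> on non-Borel sets makes set functions that agree on the Borel sets equal.\<close>

typedef (overloaded) 'a::topological_space signed_measure =
  "{\<mu> :: 'a set \<Rightarrow> real. signed_borel \<mu>}"
  morphisms smeasure Abs_signed_measure
  by (rule exI[of _ "\<lambda>_. 0"]) (simp add: signed_borel_def)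

setup_lifting type_definition_signed_measure

lemma smeasure_sums:
  "range A \<subseteq> sets borel \<Longrightarrow> disjoint_family A \<Longrightarrow>
     (\<lambda>i. smeasure \<mu> (A i)) sums smeasure \<mu> (\<Union>i::nat. A i)"
  using smeasure[of \<mu>] by (simp add: signed_borel_def)

lemma smeasure_not_borel: "A \<notin> sets borel \<Longrightarrow> smeasure \<mu> A = 0"
  using smeasure[of \<mu>] by (simp add: signed_borel_def)

lemma smeasure_eqI: "(\<And>A. A \<in> sets borel \<Longrightarrow> smeasure \<mu> A = smeasure \<nu> A) \<Longrightarrow> \<mu> = \<nu>"
  by (metis smeasure_inject smeasure_not_borel ext)

lemma smeasure_empty [simp]: "smeasure \<mu> {} = 0"
proof -
  have "(\<lambda>i::nat. smeasure \<mu> {}) sums smeasure \<mu> {}"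
    using smeasure_sums[of "\<lambda>_. {}" \<mu>] by (simp add: disjoint_family_on_def)
  then have "summable (\<lambda>i::nat. smeasure \<mu> {})" by (rule sums_summable)
  then show ?thesis by (simp add: summable_const_iff)
qed

lemma smeasure_Un:
  assumes "A \<in> sets borel" "B \<in> sets borel" "A \<inter> B = {}"
  shows "smeasure \<mu> (A \<union> B) = smeasure \<mu> A + smeasure \<mu> B"
proof -
  have "(\<lambda>i. smeasure \<mu> (binaryset A B i)) sums smeasure \<mu> (\<Union>i. binaryset A B i)"
    using assms by (intro smeasure_sums) (auto simp: range_binaryset_eq disjoint_family_on_def binaryset_def)
  moreover have "(\<lambda>i. smeasure \<mu> (binaryset A B i)) sums (smeasure \<mu> A + smeasure \<mu> B)"
    by (rule binaryset_sums) simp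
  ultimately show ?thesis by (metis UN_binaryset_eq sums_unique2)
qed

lemma smeasure_Diff:
  assumes "A \<in> sets borel" "B \<in> sets borel" "B \<subseteq> A"
  shows "smeasure \<mu> (A - B) = smeasure \<mu> A - smeasure \<mu> B"
proof -
  have "(A - B) \<inter> B = {}" "A - B \<union> B = A" using assms(3) by auto
  then show ?thesis using smeasure_Un[of "A - B" B \<mu>] assms by (simp add: sets.Diff)
qed

lemma smeasure_Union:
  assumes "finite P" "P \<subseteq> sets borel" "disjoint P"
  shows "smeasure \<mu> (\<Union>P) = (\<Sum>A\<in>P. smeasure \<mu> A)"
  using assms
proof (induction P rule: finite_induct)
  case (insert A P)
  then have "A \<inter> \<Union>P = {}" "\<Union>P \<in> sets borel"
    by (auto simp: pairwise_insert disjnt_def)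
  with insert show ?case
    by (simp add: smeasure_Un pairwise_insert)
qed simp

lemma smeasure_bounded: "\<exists>B. \<forall>A. \<bar>smeasure \<mu> A\<bar> \<le> B"
proof (rule ccontr)
  assume nb: "\<not> ?thesis"
  define bad where "bad E \<longleftrightarrow> E \<in> sets borel \<and>
    (\<forall>B. \<exists>F\<in>sets borel. F \<subseteq> E \<and> B < \<bar>smeasure \<mu> F\<bar>)" for E
  have bad0: "bad UNIV"
    unfolding bad_def
  proof safe
    fix B
    obtain A where A: "\<bar>B\<bar> < \<bar>smeasure \<mu> A\<bar>" using nb not_le by blast
    then have "A \<in> sets borel" using smeasure_not_borel[of A \<mu>] by fastforce
    then show "\<exists>F\<in>sets borel. F \<subseteq> UNIV \<and> B < \<bar>smeasure \<mu> F\<bar>"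
      using A by (intro bexI[of _ A]) auto
  qed simp
  have step: "\<exists>E'. bad E' \<and> E' \<subseteq> E \<and> 1 < \<bar>smeasure \<mu> (E - E')\<bar>" if E: "bad E" for E
  proof -
    obtain F where F: "F \<in> sets borel" "F \<subseteq> E" "\<bar>smeasure \<mu> E\<bar> + 1 < \<bar>smeasure \<mu> F\<bar>"
      using E unfolding bad_def by blast
    have Eb: "E \<in> sets borel" using E by (simp add: bad_def)
    have diff: "smeasure \<mu> (E - F) = smeasure \<mu> E - smeasure \<mu> F"
      using F Eb by (simp add: smeasure_Diff)
    have "bad F \<or> bad (E - F)"
    proof (rule ccontr)
      assume "\<not> (bad F \<or> bad (E - F))"
      then obtain B1 B2 where
        B1: "\<And>G. G \<in> sets borel \<Longrightarrow> G \<subseteq> F \<Longrightarrow> \<bar>smeasure \<mu> G\<bar> \<le> B1" and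
        B2: "\<And>G. G \<in> sets borel \<Longrightarrow> G \<subseteq> E - F \<Longrightarrow> \<bar>smeasure \<mu> G\<bar> \<le> B2"
        using F(1) Eb unfolding bad_def by (metis not_le sets.Diff)
      obtain G where G: "G \<in> sets borel" "G \<subseteq> E" "B1 + B2 < \<bar>smeasure \<mu> G\<bar>"
        using E unfolding bad_def by blast
      have "smeasure \<mu> G = smeasure \<mu> (G \<inter> F) + smeasure \<mu> (G - F)"
        using smeasure_Un[of "G \<inter> F" "G - F" \<mu>] G F by (simp add: Int_Diff_Un Int_Diff_disjoint sets.Diff sets.Int)
      then show False
        using B1[of "G \<inter> F"] B2[OF sets.Diff[OF G(1) F(1)] Diff_mono[OF G(2) order_refl]] G F by (auto simp: sets.Int)
    qed
    then show ?thesis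
    proof
      assume "bad F"
      then show ?thesis using F diff by (intro exI[of _ F]) auto
    next
      assume "bad (E - F)"
      moreover have "E - (E - F) = F" using F by auto
      ultimately show ?thesis using F by (intro exI[of _ "E - F"]) auto
    qed
  qed
  obtain E where E: "\<And>n. bad (E n)" "\<And>n. E (Suc n) \<subseteq> E n"
      "\<And>n. 1 < \<bar>smeasure \<mu> (E n - E (Suc n))\<bar>"
    using dependent_nat_choice[of "\<lambda>_. bad" "\<lambda>_ E E'. E' \<subseteq> E \<and> 1 < \<bar>smeasure \<mu> (E - E')\<bar>"] bad0 step
    by metis
  have dec: "E m \<subseteq> E n" if "n \<le> m" for m n
    using E(2) that by (rule lift_Suc_antimono_le)
  have "disjoint_family (\<lambda>n. E n - E (Suc n))"
    unfolding disjoint_family_on_def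
  proof (intro ballI impI)
    fix m n :: nat assume "m \<noteq> n"
    then consider "Suc m \<le> n" | "Suc n \<le> m" by linarith
    then show "(E m - E (Suc m)) \<inter> (E n - E (Suc n)) = {}"
      by cases (use dec in blast)+
  qed
  moreover have "range (\<lambda>n. E n - E (Suc n)) \<subseteq> sets borel"
    using E(1) by (auto simp: bad_def)
  ultimately have "(\<lambda>n. smeasure \<mu> (E n - E (Suc n))) \<longlonglongrightarrow> 0"
    using smeasure_sums sums_summable summable_LIMSEQ_zero by blast
  then have "\<forall>\<^sub>F n in sequentially. \<bar>smeasure \<mu> (E n - E (Suc n))\<bar> < 1"
    by (auto simp: tendsto_iff dist_real_def)
  then obtain N where "\<bar>smeasure \<mu> (E N - E (Suc N))\<bar> < 1"
    by (auto simp: eventually_sequentially)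
  with E(3)[of N] show False by simp
qed

subsection \<open>The normed space of signed measures\<close>

instantiation signed_measure :: (topological_space) real_vector
begin

lift_definition zero_signed_measure :: "'a signed_measure" is "\<lambda>_. 0"
  by (simp add: signed_borel_def)

lift_definition plus_signed_measure :: "'a signed_measure \<Rightarrow> 'a signed_measure \<Rightarrow> 'a signed_measure"
  is "\<lambda>\<mu> \<nu> A. \<mu> A + \<nu> A"
  by (auto simp: signed_borel_def intro: sums_add)

lift_definition minus_signed_measure :: "'a signed_measure \<Rightarrow> 'a signed_measure \<Rightarrow> 'a signed_measure"
  is "\<lambda>\<mu> \<nu> A. \<mu> A - \<nu> A"
  by (auto simp: signed_borel_def intro: sums_diff)

lift_definition uminus_signed_measure :: "'a signed_measure \<Rightarrow> 'a signed_measure"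
  is "\<lambda>\<mu> A. - \<mu> A"
  by (auto simp: signed_borel_def intro: sums_minus)

lift_definition scaleR_signed_measure :: "real \<Rightarrow> 'a signed_measure \<Rightarrow> 'a signed_measure"
  is "\<lambda>r \<mu> A. r * \<mu> A"
  by (auto simp: signed_borel_def intro: sums_mult)

instance
  by standard (transfer; auto simp: algebra_simps)+

end

lemmas smeasure_ops [simp] =
  zero_signed_measure.rep_eq plus_signed_measure.rep_eq minus_signed_measure.rep_eq
  uminus_signed_measure.rep_eq scaleR_signed_measure.rep_eq

definition borel_partition :: "'a::topological_space set set \<Rightarrow> bool" where
  "borel_partition P \<longleftrightarrow> finite P \<and> P \<subseteq> sets borel \<and> disjoint P \<and> \<Union>P = UNIV"

definition total_variation :: "'a::topological_space signed_measure \<Rightarrow> real" where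
  "total_variation \<mu> = (SUP P\<in>{P. borel_partition P}. \<Sum>A\<in>P. \<bar>smeasure \<mu> A\<bar>)"

lemma borel_partition_UNIV: "borel_partition {UNIV}"
  by (simp add: borel_partition_def)

lemma variation_bdd: "bdd_above ((\<lambda>P. \<Sum>A\<in>P. \<bar>smeasure \<mu> A\<bar>) ` {P. borel_partition P})"
proof -
  obtain B where B: "\<And>A. \<bar>smeasure \<mu> A\<bar> \<le> B" using smeasure_bounded by blast
  have "(\<Sum>A\<in>P. \<bar>smeasure \<mu> A\<bar>) \<le> 2 * B" if P: "borel_partition P" for P
  proof -
    let ?Q = "{A\<in>P. 0 \<le> smeasure \<mu> A}" and ?R = "{A\<in>P. \<not> 0 \<le> smeasure \<mu> A}"
    have fin: "finite P" using P by (simp add: borel_partition_def)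
    have "(\<Sum>A\<in>P. \<bar>smeasure \<mu> A\<bar>) = (\<Sum>A\<in>?Q \<union> ?R. \<bar>smeasure \<mu> A\<bar>)"
      by (rule sum.cong) auto
    also have "\<dots> = (\<Sum>A\<in>?Q. \<bar>smeasure \<mu> A\<bar>) + (\<Sum>A\<in>?R. \<bar>smeasure \<mu> A\<bar>)"
      using fin by (intro sum.union_disjoint) auto
    also have "\<dots> = (\<Sum>A\<in>?Q. smeasure \<mu> A) - (\<Sum>A\<in>?R. smeasure \<mu> A)"
      by (simp add: sum_negf[symmetric])
    also have "\<dots> = smeasure \<mu> (\<Union>?Q) - smeasure \<mu> (\<Union>?R)"
      using P by (subst (1 2) smeasure_Union) (auto simp: borel_partition_def intro: pairwise_subset)
    also have "\<dots> \<le> 2 * B" using B[of "\<Union>?Q"] B[of "\<Union>?R"] by linarith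
    finally show ?thesis .
  qed
  then show ?thesis by (intro bdd_aboveI2) auto
qed

lemma variation_le_tv:
  "borel_partition P \<Longrightarrow> (\<Sum>A\<in>P. \<bar>smeasure \<mu> A\<bar>) \<le> total_variation \<mu>"
  unfolding total_variation_def by (rule cSUP_upper[OF _ variation_bdd]) simp

lemma tv_le:
  "(\<And>P. borel_partition P \<Longrightarrow> (\<Sum>A\<in>P. \<bar>smeasure \<mu> A\<bar>) \<le> b) \<Longrightarrow> total_variation \<mu> \<le> b"
  unfolding total_variation_def using borel_partition_UNIV by (intro cSUP_least) auto

lemma abs_smeasure_le_tv: "\<bar>smeasure \<mu> A\<bar> \<le> total_variation \<mu>"
proof (cases "A \<in> sets borel")
  case True
  then have P: "borel_partition {A, - A}"
    by (auto simp: borel_partition_def pairwise_insert disjnt_def)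
  have "\<bar>smeasure \<mu> A\<bar> \<le> (\<Sum>B\<in>{A, - A}. \<bar>smeasure \<mu> B\<bar>)"
    by (rule member_le_sum[of A]) auto
  also have "\<dots> \<le> total_variation \<mu>" by (rule variation_le_tv[OF P])
  finally show ?thesis .
next
  case False
  have "0 \<le> \<bar>smeasure \<mu> UNIV\<bar>" by simp
  also have "\<dots> \<le> total_variation \<mu>" using variation_le_tv[OF borel_partition_UNIV] by simp
  finally show ?thesis using False by (simp add: smeasure_not_borel)
qed

lemma tv_nonneg: "0 \<le> total_variation \<mu>"
  using abs_smeasure_le_tv[of \<mu> UNIV] by linarith

lemma tv_scaleR_le: "total_variation (r *\<^sub>R \<mu>) \<le> \<bar>r\<bar> * total_variation \<mu>"
  by (rule tv_le)
     (auto simp: abs_mult sum_distrib_left[symmetric] intro!: mult_left_mono variation_le_tv)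

instantiation signed_measure :: (topological_space) real_normed_vector
begin

definition norm_signed_measure :: "'a signed_measure \<Rightarrow> real" where
  "norm_signed_measure = total_variation"

definition dist_signed_measure :: "'a signed_measure \<Rightarrow> 'a signed_measure \<Rightarrow> real" where
  "dist_signed_measure \<mu> \<nu> = norm (\<mu> - \<nu>)"

definition sgn_signed_measure :: "'a signed_measure \<Rightarrow> 'a signed_measure" where
  "sgn_signed_measure \<mu> = \<mu> /\<^sub>R norm \<mu>"

definition uniformity_signed_measure :: "('a signed_measure \<times> 'a signed_measure) filter" where
  "uniformity_signed_measure = (INF e\<in>{0 <..}. principal {(x, y). dist x y < e})"

definition open_signed_measure :: "'a signed_measure set \<Rightarrow> bool" where
  "open_signed_measure S = (\<forall>x\<in>S. \<forall>\<^sub>F (x', y) in uniformity. x' = x \<longrightarrow> y \<in> S)"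

instance
proof
  fix \<mu> \<nu> :: "'a signed_measure" and r :: real
  show "norm \<mu> = 0 \<longleftrightarrow> \<mu> = 0"
  proof
    assume "norm \<mu> = 0"
    then show "\<mu> = 0"
      using abs_smeasure_le_tv[of \<mu>] by (intro smeasure_eqI) (simp add: norm_signed_measure_def)
  next
    assume "\<mu> = 0"
    then show "norm \<mu> = 0"
      using tv_scaleR_le[of 0 \<mu>] tv_nonneg[of \<mu>] by (simp add: norm_signed_measure_def)
  qed
  show "norm (\<mu> + \<nu>) \<le> norm \<mu> + norm \<nu>"
    unfolding norm_signed_measure_def
  proof (rule tv_le)
    fix P :: "'a set set" assume P: "borel_partition P"
    have "(\<Sum>A\<in>P. \<bar>smeasure (\<mu> + \<nu>) A\<bar>)
        \<le> (\<Sum>A\<in>P. \<bar>smeasure \<mu> A\<bar>) + (\<Sum>A\<in>P. \<bar>smeasure \<nu> A\<bar>)"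
      by (simp add: sum.distrib[symmetric] sum_mono abs_triangle_ineq)
    also have "\<dots> \<le> total_variation \<mu> + total_variation \<nu>"
      by (intro add_mono variation_le_tv P)
    finally show "(\<Sum>A\<in>P. \<bar>smeasure (\<mu> + \<nu>) A\<bar>) \<le> total_variation \<mu> + total_variation \<nu>" .
  qed
  show "norm (r *\<^sub>R \<mu>) = \<bar>r\<bar> * norm \<mu>"
  proof (cases "r = 0")
    case True
    then show ?thesis
      using tv_scaleR_le[of 0 \<mu>] tv_nonneg[of "0 *\<^sub>R \<mu>"] by (simp add: norm_signed_measure_def)
  next
    case False
    have "\<bar>r\<bar> * total_variation \<mu> = \<bar>r\<bar> * total_variation ((1 / r) *\<^sub>R r *\<^sub>R \<mu>)"
      using False by simp
    also have "\<dots> \<le> \<bar>r\<bar> * (\<bar>1 / r\<bar> * total_variation (r *\<^sub>R \<mu>))"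
      by (intro mult_left_mono tv_scaleR_le) simp
    also have "\<dots> = total_variation (r *\<^sub>R \<mu>)" using False by (simp add: abs_divide)
    finally show ?thesis
      using tv_scaleR_le[of r \<mu>] by (simp add: norm_signed_measure_def)
  qed
qed (simp_all add: dist_signed_measure_def sgn_signed_measure_def
      uniformity_signed_measure_def open_signed_measure_def)

end

instantiation signed_measure :: (topological_space) order
begin

definition less_eq_signed_measure :: "'a signed_measure \<Rightarrow> 'a signed_measure \<Rightarrow> bool" where
  "\<mu> \<le> \<nu> \<longleftrightarrow> (\<forall>A\<in>sets borel. smeasure \<mu> A \<le> smeasure \<nu> A)"

definition less_signed_measure :: "'a signed_measure \<Rightarrow> 'a signed_measure \<Rightarrow> bool" where
  "\<mu> < \<nu> \<longleftrightarrow> \<mu> \<le> \<nu> \<and> \<not> \<nu> \<le> (\<mu> :: 'a signed_measure)"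

instance
proof
  fix \<mu> \<nu> \<tau> :: "'a signed_measure"
  show "\<mu> \<le> \<nu> \<Longrightarrow> \<nu> \<le> \<mu> \<Longrightarrow> \<mu> = \<nu>"
    by (intro smeasure_eqI) (auto simp: less_eq_signed_measure_def intro: antisym)
qed (auto simp: less_eq_signed_measure_def less_signed_measure_def intro: order_trans)

end

subsection \<open>Restriction and support\<close>

text \<open>For Borel \<open>A\<close> this is $1_A\mu$; the guard only serves the type invariant.\<close>

lift_definition restr :: "'a::topological_space set \<Rightarrow> 'a signed_measure \<Rightarrow> 'a signed_measure"
  is "\<lambda>A \<mu> E. if A \<in> sets borel \<and> E \<in> sets borel then \<mu> (A \<inter> E) else 0"
proof -
  fix A :: "'a set" and \<mu> :: "'a set \<Rightarrow> real" assume *: "signed_borel \<mu>"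
  show "signed_borel (\<lambda>E. if A \<in> sets borel \<and> E \<in> sets borel then \<mu> (A \<inter> E) else 0)"
  proof (cases "A \<in> sets borel")
    case True
    have "(\<lambda>i. \<mu> (A \<inter> F i)) sums \<mu> (A \<inter> (\<Union>i. F i))"
      if "range F \<subseteq> sets borel" "disjoint_family F" for F :: "nat \<Rightarrow> 'a set"
    proof -
      have "range (\<lambda>i. A \<inter> F i) \<subseteq> sets borel" using that True by auto
      moreover have "disjoint_family (\<lambda>i. A \<inter> F i)"
        using that by (auto simp: disjoint_family_on_def)
      ultimately show ?thesis
        using * unfolding signed_borel_def Int_UN_distrib by blast
    qed
    then show ?thesis
      using True by (auto simp: signed_borel_def image_subset_iff)
  qed (simp add: signed_borel_def)
qed

lemma smeasure_restr [simp]: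
  "A \<in> sets borel \<Longrightarrow> E \<in> sets borel \<Longrightarrow> smeasure (restr A \<mu>) E = smeasure \<mu> (A \<inter> E)"
  by (simp add: restr.rep_eq)

text \<open>A point is in the support iff no open neighbourhood of it is $|\mu|$-null; an open \<open>U\<close>
  is $|\mu|$-null iff $1_U\mu = 0$.\<close>

definition supp :: "'a::topological_space signed_measure \<Rightarrow> 'a set" where
  "supp \<mu> = {x. \<forall>U. open U \<longrightarrow> x \<in> U \<longrightarrow> restr U \<mu> \<noteq> 0}"

definition compactly_supported :: "'a::topological_space signed_measure \<Rightarrow> bool" where
  "compactly_supported \<mu> \<longleftrightarrow> compact (supp \<mu>)"

subsection \<open>Jordan decomposition and integration\<close>

definition upper_variation :: "'a::topological_space signed_measure \<Rightarrow> 'a set \<Rightarrow> real" where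
  "upper_variation \<mu> A = (SUP B\<in>{B \<in> sets borel. B \<subseteq> A}. smeasure \<mu> B)"

definition pos_part :: "'a::topological_space signed_measure \<Rightarrow> 'a measure" where
  "pos_part \<mu> = measure_of UNIV (sets borel) (\<lambda>A. ennreal (upper_variation \<mu> A))"

definition neg_part :: "'a::topological_space signed_measure \<Rightarrow> 'a measure" where
  "neg_part \<mu> = pos_part (- \<mu>)"

definition sintegral :: "'a::topological_space signed_measure \<Rightarrow> ('a \<Rightarrow> real) \<Rightarrow> real" where
  "sintegral \<mu> f = integral\<^sup>L (pos_part \<mu>) f - integral\<^sup>L (neg_part \<mu>) f"

lemma upper_variation_bdd: "bdd_above (smeasure \<mu> ` {B \<in> sets borel. B \<subseteq> A})"
  using abs_smeasure_le_tv[of \<mu>] by (intro bdd_aboveI2[where M = "total_variation \<mu>"]) (meson abs_le_D1)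

lemma upper_variation_ge:
  "B \<in> sets borel \<Longrightarrow> B \<subseteq> A \<Longrightarrow> smeasure \<mu> B \<le> upper_variation \<mu> A"
  unfolding upper_variation_def by (rule cSUP_upper[OF _ upper_variation_bdd]) simp

lemma upper_variation_le:
  "(\<And>B. B \<in> sets borel \<Longrightarrow> B \<subseteq> A \<Longrightarrow> smeasure \<mu> B \<le> b) \<Longrightarrow> upper_variation \<mu> A \<le> b"
  unfolding upper_variation_def by (rule cSUP_least) auto

lemma upper_variation_nonneg: "0 \<le> upper_variation \<mu> A"
  using upper_variation_ge[of "{}" A \<mu>] by simp

lemma upper_variation_empty: "upper_variation \<mu> {} = 0"
  by (intro antisym upper_variation_nonneg upper_variation_le) auto

lemma upper_variation_mono: "A \<subseteq> B \<Longrightarrow> upper_variation \<mu> A \<le> upper_variation \<mu> B"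
  by (intro upper_variation_le upper_variation_ge) auto

lemma upper_variation_super:
  assumes "A \<inter> B = {}"
  shows "upper_variation \<mu> A + upper_variation \<mu> B \<le> upper_variation \<mu> (A \<union> B)"
proof -
  have "upper_variation \<mu> A \<le> upper_variation \<mu> (A \<union> B) - upper_variation \<mu> B"
  proof (rule upper_variation_le)
    fix C assume C: "C \<in> sets borel" "C \<subseteq> A"
    have "upper_variation \<mu> B \<le> upper_variation \<mu> (A \<union> B) - smeasure \<mu> C"
    proof (rule upper_variation_le)
      fix D assume D: "D \<in> sets borel" "D \<subseteq> B"
      have "smeasure \<mu> C + smeasure \<mu> D = smeasure \<mu> (C \<union> D)"
        using C D assms by (subst smeasure_Un) auto
      also have "\<dots> \<le> upper_variation \<mu> (A \<union> B)"
        using C D by (intro upper_variation_ge) auto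
      finally show "smeasure \<mu> D \<le> upper_variation \<mu> (A \<union> B) - smeasure \<mu> C" by simp
    qed
    then show "smeasure \<mu> C \<le> upper_variation \<mu> (A \<union> B) - upper_variation \<mu> B" by simp
  qed
  then show ?thesis by simp
qed

lemma upper_variation_sums:
  assumes A: "range A \<subseteq> sets borel" "disjoint_family A"
  shows "(\<lambda>i::nat. upper_variation \<mu> (A i)) sums upper_variation \<mu> (\<Union>i. A i)"
proof -
  have part: "(\<Sum>i<n. upper_variation \<mu> (A i)) \<le> upper_variation \<mu> (\<Union>i<n. A i)" for n
  proof (induction n)
    case (Suc n)
    have "(\<Union>i<n. A i) \<inter> A n = {}"
      using A(2) unfolding disjoint_family_on_def by (blast dest: less_imp_neq)
    from upper_variation_super[OF this, of \<mu>] Suc show ?case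
      by (simp add: lessThan_Suc Un_commute)
  qed (simp add: upper_variation_empty)
  have bound: "(\<Sum>i<n. upper_variation \<mu> (A i)) \<le> upper_variation \<mu> (\<Union>i. A i)" for n
    by (rule order_trans[OF part upper_variation_mono]) auto
  have summ: "summable (\<lambda>i. upper_variation \<mu> (A i))"
    by (rule summableI_nonneg_bounded[OF upper_variation_nonneg bound])
  have "upper_variation \<mu> (\<Union>i. A i) \<le> (\<Sum>i. upper_variation \<mu> (A i))"
  proof (rule upper_variation_le)
    fix B assume B: "B \<in> sets borel" "B \<subseteq> (\<Union>i. A i)"
    have "(\<lambda>i. smeasure \<mu> (B \<inter> A i)) sums smeasure \<mu> (\<Union>i. B \<inter> A i)"
      using A B by (intro smeasure_sums) (auto simp: disjoint_family_on_def)
    moreover have "(\<Union>i. B \<inter> A i) = B" using B by auto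
    ultimately have "smeasure \<mu> B = (\<Sum>i. smeasure \<mu> (B \<inter> A i))"
        "summable (\<lambda>i. smeasure \<mu> (B \<inter> A i))"
      by (auto simp: sums_iff)
    then show "smeasure \<mu> B \<le> (\<Sum>i. upper_variation \<mu> (A i))"
      using A B summ by (auto intro!: suminf_le upper_variation_ge)
  qed
  moreover have "(\<Sum>i. upper_variation \<mu> (A i)) \<le> upper_variation \<mu> (\<Union>i. A i)"
    by (rule suminf_le_const[OF summ bound])
  ultimately show ?thesis using summ by (simp add: sums_iff)
qed

lemma sets_pos_part [simp, measurable_cong]: "sets (pos_part \<mu>) = sets borel"
  unfolding pos_part_def by (metis sets.sets_measure_of_eq space_borel)

lemma space_pos_part [simp]: "space (pos_part \<mu>) = UNIV"
  by (metis sets_pos_part sets_eq_imp_space_eq space_borel)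

lemma emeasure_pos_part:
  assumes "A \<in> sets borel"
  shows "emeasure (pos_part \<mu>) A = ennreal (upper_variation \<mu> A)"
  unfolding pos_part_def
proof (rule emeasure_measure_of_sigma)
  show "sigma_algebra UNIV (sets (borel :: 'a measure))"
    by (metis sets.sigma_algebra_axioms space_borel)
  show "positive (sets borel) (\<lambda>A. ennreal (upper_variation \<mu> A))"
    by (simp add: positive_def upper_variation_empty)
  show "countably_additive (sets borel) (\<lambda>A. ennreal (upper_variation \<mu> A))"
    unfolding countably_additive_def
    using upper_variation_sums[of _ \<mu>] upper_variation_nonneg[of \<mu>]
    by (auto simp: suminf_ennreal2 sums_iff)
qed fact

lemma finite_measure_pos_part: "finite_measure (pos_part \<mu>)"
  by (rule finite_measureI) (simp add: emeasure_pos_part)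

lemma jordan_decomposition:
  assumes "A \<in> sets borel"
  shows "smeasure \<mu> A = measure (pos_part \<mu>) A - measure (neg_part \<mu>) A"
proof -
  have "upper_variation \<nu> A \<le> upper_variation (- \<nu>) A + smeasure \<nu> A" for \<nu> :: "'a signed_measure"
  proof (rule upper_variation_le)
    fix B assume B: "B \<in> sets borel" "B \<subseteq> A"
    have "smeasure (- \<nu>) (A - B) \<le> upper_variation (- \<nu>) A"
      using B assms by (intro upper_variation_ge) auto
    then show "smeasure \<nu> B \<le> upper_variation (- \<nu>) A + smeasure \<nu> A"
      using B assms by (simp add: smeasure_Diff)
  qed
  from this[of \<mu>] this[of "- \<mu>"] show ?thesis
    using assms by (simp add: neg_part_def measure_def emeasure_pos_part upper_variation_nonneg)
qed

section \<open>Plans\<close>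

definition plans :: "'a::topological_space signed_measure \<Rightarrow> 'a signed_measure \<Rightarrow> ('a \<times> 'a) measure set"
  where "plans \<mu> \<rho> = {\<kappa>. sets \<kappa> = sets borel \<and> finite_measure \<kappa> \<and>
     (\<forall>A\<in>sets borel. measure \<kappa> (A \<times> UNIV) = smeasure \<mu> A) \<and>
     (\<forall>B\<in>sets borel. measure \<kappa> (UNIV \<times> B) = smeasure \<rho> B)}"

lemma AE_supp:
  fixes \<mu> :: "'a::second_countable_topology signed_measure"
  assumes f: "f \<in> borel_measurable \<kappa>" and fin: "finite_measure \<kappa>"
    and marg: "\<And>A. A \<in> sets borel \<Longrightarrow> measure \<kappa> (f -` A \<inter> space \<kappa>) = smeasure \<mu> A"
  shows "AE z in \<kappa>. f z \<in> supp \<mu>"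
proof -
  interpret finite_measure \<kappa> by fact
  obtain \<U> where \<U>: "\<U> \<subseteq> {U. open U \<and> restr U \<mu> = 0}" "countable \<U>"
      "\<Union>\<U> = \<Union>{U. open U \<and> restr U \<mu> = 0}"
    by (rule Lindelof[of "{U. open U \<and> restr U \<mu> = 0}"]) auto
  have "AE z in \<kappa>. f z \<notin> U" if "U \<in> \<U>" for U
  proof -
    have U: "open U" "restr U \<mu> = 0" using that \<U> by auto
    then have "smeasure \<mu> U = 0"
      using smeasure_restr[of U UNIV \<mu>] by simp
    then have "measure \<kappa> (f -` U \<inter> space \<kappa>) = 0"
      using U marg[of U] by simp
    moreover have "f -` U \<inter> space \<kappa> \<in> sets \<kappa>"
      using f U by (auto intro: measurable_sets)
    ultimately have "f -` U \<inter> space \<kappa> \<in> null_sets \<kappa>"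
      by (simp add: null_sets_def emeasure_eq_measure)
    then show ?thesis by (rule AE_I') auto
  qed
  then have "AE z in \<kappa>. \<forall>U\<in>\<U>. f z \<notin> U"
    using \<U>(2) by (simp add: AE_ball_countable)
  then show ?thesis
  proof eventually_elim
    case (elim z)
    then have "f z \<notin> \<Union>{U. open U \<and> restr U \<mu> = 0}" using \<U>(3) by auto
    then show ?case by (auto simp: supp_def)
  qed
qed

text \<open>Hence a Lebesgue integral of a continuous cost against a plan between compactly supported
  marginals never takes the default value for non-integrable functions.\<close>

lemma plans_integrable:
  fixes \<mu> \<rho> :: "'a::second_countable_topology signed_measure" and c :: "'a \<times> 'a \<Rightarrow> real"
  assumes \<kappa>: "\<kappa> \<in> plans \<mu> \<rho>" and cs: "compactly_supported \<mu>" "compactly_supported \<rho>"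
    and c: "continuous_on UNIV c"
  shows "integrable \<kappa> c"
proof -
  have s [measurable_cong]: "sets \<kappa> = sets borel" and fin: "finite_measure \<kappa>"
    using \<kappa> by (auto simp: plans_def)
  have sp: "space \<kappa> = UNIV" using sets_eq_imp_space_eq[OF s] by simp
  have fst: "fst \<in> borel_measurable \<kappa>" and snd: "snd \<in> borel_measurable \<kappa>"
    and cm: "c \<in> borel_measurable \<kappa>"
    using c by (auto simp: measurable_cong_sets[OF s refl] intro!: borel_measurable_continuous_onI continuous_intros)
  have v: "fst -` A = A \<times> (UNIV :: 'a set)" "snd -` A = (UNIV :: 'a set) \<times> A" for A :: "'a set" by auto
  have 1: "AE z in \<kappa>. fst z \<in> supp \<mu>"
    using \<kappa> by (intro AE_supp[OF fst fin]) (auto simp: plans_def sp v)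
  have 2: "AE z in \<kappa>. snd z \<in> supp \<rho>"
    using \<kappa> by (intro AE_supp[OF snd fin]) (auto simp: plans_def sp v)
  have "compact (c ` (supp \<mu> \<times> supp \<rho>))"
    using cs c by (intro compact_continuous_image compact_Times)
      (auto simp: compactly_supported_def intro: continuous_on_subset)
  then obtain B where B: "\<And>z. z \<in> supp \<mu> \<times> supp \<rho> \<Longrightarrow> norm (c z) \<le> B"
    by (meson compact_imp_bounded bounded_iff imageI)
  have "AE z in \<kappa>. norm (c z) \<le> B"
    using 1 2 by eventually_elim (rule B, simp add: mem_Times_iff)
  then show ?thesis by (rule finite_measure.integrable_const_bound[OF fin _ cm])
qed

section \<open>Transfunctions\<close>

type_synonym 'a transfunction = "'a signed_measure \<Rightarrow> 'a signed_measure"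

definition simple_transfunction :: "'a::topological_space transfunction \<Rightarrow> bool" where
  "simple_transfunction \<Phi> \<longleftrightarrow>
     (\<exists>(m::nat) (f :: nat \<Rightarrow> 'a \<Rightarrow> real) (\<rho> :: nat \<Rightarrow> 'a signed_measure).
        (\<forall>i\<in>{1..m}. f i \<in> bcontfun) \<and>
        (\<forall>\<sigma>. \<Phi> \<sigma> = (\<Sum>i=1..m. sintegral \<sigma> (f i) *\<^sub>R \<rho> i)))"

definition markov_transfunction :: "'a::topological_space transfunction \<Rightarrow> bool" where
  "markov_transfunction \<Phi> \<longleftrightarrow>
     linear \<Phi> \<and> continuous_on UNIV \<Phi> \<and>
     (\<forall>\<sigma>. 0 \<le> \<sigma> \<longrightarrow> 0 \<le> \<Phi> \<sigma>) \<and>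
     (\<forall>\<sigma>. smeasure (\<Phi> \<sigma>) UNIV = smeasure \<sigma> UNIV)"

definition is_plan_of ::
  "'a::topological_space transfunction \<Rightarrow> 'a signed_measure \<Rightarrow> ('a \<times> 'a) measure \<Rightarrow> bool" where
  "is_plan_of \<Phi> \<mu> \<kappa> \<longleftrightarrow> \<kappa> \<in> plans \<mu> (\<Phi> \<mu>) \<and>
     (\<forall>A\<in>sets borel. \<forall>B\<in>sets borel. measure \<kappa> (A \<times> B) = smeasure (\<Phi> (restr A \<mu>)) B)"

text \<open>There is at most one such plan, so asserting a property of some \<open>\<kappa>\<close> with
  \<open>is_plan_of \<Phi> \<mu> \<kappa>\<close> asserts it of the plan corresponding to \<open>\<Phi>\<close> on \<open>\<mu>\<close>.\<close>

lemma is_plan_of_unique: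
  fixes \<mu> :: "'a::second_countable_topology signed_measure"
  assumes "is_plan_of \<Phi> \<mu> \<kappa>" "is_plan_of \<Phi> \<mu> \<kappa>'"
  shows "\<kappa> = \<kappa>'"
proof (rule measure_eqI_generator_eq[where A = "\<lambda>_. UNIV"
      and E = "{A \<times> B | A B. A \<in> sets borel \<and> B \<in> sets borel}" and \<Omega> = UNIV])
  interpret \<kappa>: finite_measure \<kappa> using assms by (auto simp: is_plan_of_def plans_def)
  interpret \<kappa>': finite_measure \<kappa>' using assms by (auto simp: is_plan_of_def plans_def)
  have "sets (borel :: ('a \<times> 'a) measure) = sets (borel \<Otimes>\<^sub>M borel)"
    unfolding borel_prod ..
  also have "\<dots> = sigma_sets UNIV {A \<times> B | A B. A \<in> sets borel \<and> B \<in> sets borel}"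
    by (simp add: sets_pair_measure)
  finally have "sets (borel :: ('a \<times> 'a) measure) =
    sigma_sets UNIV {A \<times> B | A B. A \<in> sets borel \<and> B \<in> sets borel}" .
  then show "sets \<kappa> = sigma_sets UNIV {A \<times> B | A B. A \<in> sets borel \<and> B \<in> sets borel}"
    "sets \<kappa>' = sigma_sets UNIV {A \<times> B | A B. A \<in> sets borel \<and> B \<in> sets borel}"
    using assms by (auto simp: is_plan_of_def plans_def)
  show "Int_stable {A \<times> B | A B. A \<in> sets (borel :: 'a measure) \<and> B \<in> sets (borel :: 'a measure)}"
    by (rule Int_stable_pair_measure_generator)
  show "emeasure \<kappa> X = emeasure \<kappa>' X"
    if "X \<in> {A \<times> B | A B. A \<in> sets borel \<and> B \<in> sets borel}" for X
    using that assms by (auto simp: is_plan_of_def \<kappa>.emeasure_eq_measure \<kappa>'.emeasure_eq_measure)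
  show "range (\<lambda>_::nat. UNIV) \<subseteq> {A \<times> B | A B. A \<in> sets (borel :: 'a measure) \<and> B \<in> sets (borel :: 'a measure)}"
    by (auto intro!: exI[of _ UNIV])
  show "emeasure \<kappa> UNIV \<noteq> \<infinity>" by simp
qed auto

end

theory Submission
  imports Defs
begin

text \<open>Let \<open>\<pi>\<close> be a nearly optimal plan, and let \<open>f\<^sub>1, \<dots>, f\<^sub>m\<close> be a continuous partition of unity on the
  whole space whose members have small diameter on the support of \<open>\<mu>\<close>. Put
  \<open>a\<^sub>i = \<integral> f\<^sub>i d\<mu>\<close>, let \<open>\<rho>\<^sub>i\<close> be the second marginal of \<open>f\<^sub>i(x) d\<pi>(x, y) / a\<^sub>i\<close>, and let
  \<open>\<Phi> \<sigma> = \<Sum>\<^sub>i (\<integral> f\<^sub>i d\<sigma>) \<rho>\<^sub>i\<close>. Since the \<open>f\<^sub>i\<close> sum to one, \<open>\<Phi>\<close> is Markov and \<open>\<Phi> \<mu> = \<rho>\<close>. The plan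
  of \<open>\<Phi>\<close> is obtained from \<open>\<pi> \<otimes> \<pi>\<close> with density \<open>\<Sum>\<^sub>i f\<^sub>i(x) f\<^sub>i(x') / a\<^sub>i\<close> at \<open>((x, y), (x', y'))\<close> by
  keeping \<open>(x, y')\<close>. Replacing \<open>x\<close> by \<open>x'\<close> gives back \<open>\<pi>\<close>, and as \<open>x\<close> and \<open>x'\<close> are
  close wherever the density is positive, uniform continuity of \<open>c\<close> on the product of
  the supports bounds the change of cost.\<close>

section \<open>Integration against signed measures\<close>

lemma finite_measure_neg_part: "finite_measure (neg_part \<sigma>)"
  by (simp add: neg_part_def finite_measure_pos_part)

lemma sets_neg_part [simp, measurable_cong]: "sets (neg_part \<sigma>) = sets borel"
  by (simp add: neg_part_def)

lemma integrable_bounded_borel: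
  fixes f :: "'a::topological_space \<Rightarrow> real"
  assumes "finite_measure M" "sets M = sets borel"
    and "f \<in> borel_measurable borel" "\<And>x. \<bar>f x\<bar> \<le> B"
  shows "integrable M f"
proof -
  have "f \<in> borel_measurable M"
    using assms(2,3) by (simp cong: measurable_cong_sets)
  then show ?thesis
    using assms(4) by (intro finite_measure.integrable_const_bound[OF assms(1), of _ B]) auto
qed

section \<open>Functionals on bounded Borel functions and their values on indicators\<close>

definition linear_on_bounded_borel :: "(('a::topological_space \<Rightarrow> real) \<Rightarrow> real) \<Rightarrow> bool" where
  "linear_on_bounded_borel T \<longleftrightarrow>
     (\<forall>f g B. f \<in> borel_measurable borel \<longrightarrow> g \<in> borel_measurable borel \<longrightarrow>
        (\<forall>x. \<bar>f x\<bar> \<le> B \<and> \<bar>g x\<bar> \<le> B) \<longrightarrow> T (\<lambda>x. f x + g x) = T f + T g) \<and>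
     (\<forall>f B r. f \<in> borel_measurable borel \<longrightarrow> (\<forall>x. \<bar>f x\<bar> \<le> B) \<longrightarrow> T (\<lambda>x. r * f x) = r * T f)"

text \<open>This is the kind of continuity that dominated convergence provides. Both notions look at
  bounded Borel functions only, because an integral takes a default value on non-integrable
  functions and need not be additive there.\<close>

definition bounded_continuous_functional :: "(('a::topological_space \<Rightarrow> real) \<Rightarrow> real) \<Rightarrow> bool" where
  "bounded_continuous_functional T \<longleftrightarrow>
     (\<forall>u f B. (\<forall>n. u n \<in> borel_measurable borel) \<longrightarrow> f \<in> borel_measurable borel \<longrightarrow>
        (\<forall>n x. \<bar>u n x\<bar> \<le> B) \<longrightarrow> (\<forall>x. (\<lambda>n. u n x) \<longlonglongrightarrow> f x) \<longrightarrow> (\<lambda>n::nat. T (u n)) \<longlonglongrightarrow> T f)"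

lemma functional_add:
  "linear_on_bounded_borel T \<Longrightarrow> f \<in> borel_measurable borel \<Longrightarrow> g \<in> borel_measurable borel \<Longrightarrow>
    (\<And>x. \<bar>f x\<bar> \<le> B) \<Longrightarrow> (\<And>x. \<bar>g x\<bar> \<le> B') \<Longrightarrow> T (\<lambda>x. f x + g x) = T f + T g"
  unfolding linear_on_bounded_borel_def by (meson max.coboundedI1 max.coboundedI2)

lemma functional_scale:
  "linear_on_bounded_borel T \<Longrightarrow> f \<in> borel_measurable borel \<Longrightarrow> (\<And>x. \<bar>f x\<bar> \<le> B) \<Longrightarrow>
    T (\<lambda>x. r * f x) = r * T f"
  unfolding linear_on_bounded_borel_def by blast

lemma functional_lim:
  "bounded_continuous_functional T \<Longrightarrow> (\<And>n. u n \<in> borel_measurable borel) \<Longrightarrow>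
    f \<in> borel_measurable borel \<Longrightarrow> (\<And>n x. \<bar>u n x\<bar> \<le> B) \<Longrightarrow> (\<And>x. (\<lambda>n. u n x) \<longlonglongrightarrow> f x) \<Longrightarrow>
    (\<lambda>n::nat. T (u n)) \<longlonglongrightarrow> T f"
  unfolding bounded_continuous_functional_def by blast

text \<open>A monotone class argument: agreement of the two functionals passes from indicators to
  sums, multiples and bounded increasing limits.\<close>

lemma functional_eqI:
  fixes f :: "'a::topological_space \<Rightarrow> real"
  assumes S: "linear_on_bounded_borel S" "bounded_continuous_functional S"
    and T: "linear_on_bounded_borel T" "bounded_continuous_functional T"
    and ind: "\<And>A. A \<in> sets borel \<Longrightarrow> S (indicator A) = T (indicator A)"
    and f [measurable]: "f \<in> borel_measurable borel" and bd: "\<And>x. \<bar>f x\<bar> \<le> B"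
  shows "S f = T f"
proof -
  \<comment> \<open>The shift by \<open>B\<close> makes the function nonnegative, as the induction
    rule requires.\<close>
  define g where "g x = f x + B" for x
  have g: "g \<in> borel_measurable borel" "\<And>x. 0 \<le> g x" "\<And>x. \<bar>g x\<bar> \<le> 2 * B"
  proof -
    show "g \<in> borel_measurable borel" unfolding g_def by measurable
    show "0 \<le> g x" "\<bar>g x\<bar> \<le> 2 * B" for x
      using bd[of x] by (auto simp: g_def)
  qed
  \<comment> \<open>The induction rule supplies no bounds, so boundedness is made a premise of the
    claim. It passes from a sum to its nonnegative summands and from an increasing limit to the
    approximating functions.\<close>
  have "(\<exists>b. \<forall>x. \<bar>g x\<bar> \<le> b) \<longrightarrow> S g = T g"
    using g(1,2)
  proof (induct rule: borel_measurable_induct_real)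
    case (set A)
    then show ?case using ind by simp
  next
    case (mult u r)
    show ?case
    proof safe
      fix b assume b: "\<forall>x. \<bar>r * u x\<bar> \<le> b"
      show "S (\<lambda>x. r * u x) = T (\<lambda>x. r * u x)"
      \<comment> \<open>For \<open>r = 0\<close> a bound on \<open>r * u\<close> gives none on
        \<open>u\<close>, so the induction hypothesis cannot be used.\<close>
      proof (cases "r = 0")
        case True
        have "S (\<lambda>_. 0) = 0" "T (\<lambda>_. 0) = 0"
          using functional_scale[OF S(1), of "\<lambda>_. 0" 0 0] functional_scale[OF T(1), of "\<lambda>_. 0" 0 0]
          by auto
        then show ?thesis using True by simp
      next
        case False
        have bu: "\<bar>u x\<bar> \<le> b / r" for x
          using b[rule_format, of x] mult False by (simp add: abs_mult field_simps)
        then have "S u = T u" using mult by blast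
        then show ?thesis
          using functional_scale[OF S(1) mult(2) bu] functional_scale[OF T(1) mult(2) bu] by simp
      qed
    qed
  next
    case (add u v)
    show ?case
    proof safe
      fix b assume b: "\<forall>x. \<bar>v x + u x\<bar> \<le> b"
      have bu: "\<bar>u x\<bar> \<le> b" and bv: "\<bar>v x\<bar> \<le> b" for x
        using b[rule_format, of x] add(2)[of x] add(5)[of x] by linarith+
      have "S u = T u" "S v = T v" using add bu bv by blast+
      then show "S (\<lambda>x. v x + u x) = T (\<lambda>x. v x + u x)"
        using functional_add[OF S(1) add(4,1) bv bu] functional_add[OF T(1) add(4,1) bv bu] by simp
    qed
  next
    case (seq U)
    show ?case
    proof safe
      fix b assume b: "\<forall>x. \<bar>g x\<bar> \<le> b"
      have lim: "(\<lambda>n. U n x) \<longlonglongrightarrow> g x" for x using seq by simp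
      have bU: "\<bar>U n x\<bar> \<le> b" for n x
      proof -
        have "U n x \<le> g x"
          using seq(4) by (intro incseq_le[OF _ lim]) (auto simp: incseq_def le_fun_def)
        then show ?thesis using b[rule_format, of x] seq(2)[of n x] by linarith
      qed
      have "S (U n) = T (U n)" for n using seq(3) bU by blast
      moreover have "(\<lambda>n. S (U n)) \<longlonglongrightarrow> S g"
        by (rule functional_lim[OF S(2) seq(1) g(1) bU lim])
      moreover have "(\<lambda>n. T (U n)) \<longlonglongrightarrow> T g"
        by (rule functional_lim[OF T(2) seq(1) g(1) bU lim])
      ultimately show "S g = T g" using LIMSEQ_unique by simp
    qed
  qed
  then have eq: "S g = T g" using g(3) by blast
  \<comment> \<open>The shift is undone: the constant \<open>B\<close> is a multiple of the
    indicator of \<open>UNIV\<close>.\<close>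
  have one: "S (\<lambda>_. 1) = T (\<lambda>_. 1)" using ind[of UNIV] by simp
  have c: "S (\<lambda>_. B) = T (\<lambda>_. B)"
    using functional_scale[OF S(1), of "\<lambda>_. 1" 1 B] functional_scale[OF T(1), of "\<lambda>_. 1" 1 B] one by simp
  have "S g = S f + S (\<lambda>_. B)" "T g = T f + T (\<lambda>_. B)"
    using functional_add[OF S(1) f _ bd, of "\<lambda>_. B" "\<bar>B\<bar>"]
      functional_add[OF T(1) f _ bd, of "\<lambda>_. B" "\<bar>B\<bar>"]
    by (auto simp: g_def[abs_def])
  then show ?thesis using eq c by simp
qed

lemma linear_integral:
  assumes "finite_measure M" "sets M = sets borel"
  shows "linear_on_bounded_borel (integral\<^sup>L M)"
  unfolding linear_on_bounded_borel_def
proof (safe, goal_cases)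
  case (1 f g B)
  then show ?case
    by (intro Bochner_Integration.integral_add integrable_bounded_borel[OF assms]) auto
qed simp

lemma continuous_integral:
  assumes "finite_measure M" "sets M = sets borel"
  shows "bounded_continuous_functional (integral\<^sup>L M)"
  unfolding bounded_continuous_functional_def
proof (safe, goal_cases)
  case (1 u f B)
  then show ?case
    using assms(2)
    by (intro integral_dominated_convergence[where w = "\<lambda>_. B"])
      (auto intro!: finite_measure.integrable_const assms(1) cong: measurable_cong_sets)
qed

section \<open>The integral against a signed measure as a function of both arguments\<close>

lemma linear_sintegral: "linear_on_bounded_borel (sintegral \<sigma>)"
  using linear_integral[OF finite_measure_pos_part[of \<sigma>] sets_pos_part]
    linear_integral[OF finite_measure_neg_part[of \<sigma>] sets_neg_part]
  unfolding linear_on_bounded_borel_def sintegral_def by (simp add: algebra_simps)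

lemma continuous_sintegral: "bounded_continuous_functional (sintegral \<sigma>)"
  unfolding bounded_continuous_functional_def sintegral_def
proof (safe, goal_cases)
  case (1 u f B)
  then show ?case
    by (intro tendsto_diff functional_lim[OF continuous_integral[OF finite_measure_pos_part]]
        functional_lim[OF continuous_integral[OF finite_measure_neg_part]]) auto
qed

lemma sintegral_indicator: "A \<in> sets borel \<Longrightarrow> sintegral \<sigma> (indicator A) = smeasure \<sigma> A"
  by (simp add: sintegral_def jordan_decomposition)

text \<open>The common tool for the identities about \<open>sintegral\<close> below: only values on
  indicators have to be compared.\<close>

lemma sintegral_eqI:
  fixes f :: "'a::topological_space \<Rightarrow> real"
  assumes "linear_on_bounded_borel T" "bounded_continuous_functional T"
    and "\<And>A. A \<in> sets borel \<Longrightarrow> T (indicator A) = smeasure \<sigma> A"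
    and "f \<in> borel_measurable borel" "\<And>x. \<bar>f x\<bar> \<le> B"
  shows "sintegral \<sigma> f = T f"
  by (rule functional_eqI[OF linear_sintegral continuous_sintegral assms(1,2) _ assms(4,5)])
    (simp add: sintegral_indicator assms(3))

text \<open>The Jordan decomposition of a sum is in general not the sum of the Jordan
  decompositions, so additivity is reduced to indicators, where it is addition of set
  functions.\<close>

lemma sintegral_add_measure:
  assumes "f \<in> borel_measurable borel" "\<And>x. \<bar>f x\<bar> \<le> B"
  shows "sintegral (\<sigma> + \<tau>) f = sintegral \<sigma> f + sintegral \<tau> f"
proof (rule sintegral_eqI[OF _ _ _ assms])
  show "linear_on_bounded_borel (\<lambda>f. sintegral \<sigma> f + sintegral \<tau> f)"
    unfolding linear_on_bounded_borel_def
  proof (safe, goal_cases)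
    case (1 g h b)
    then show ?case
      using functional_add[OF linear_sintegral, of g h b b \<sigma>] functional_add[OF linear_sintegral, of g h b b \<tau>]
      by simp
  next
    case (2 g b r)
    then show ?case
      using functional_scale[OF linear_sintegral, of g b \<sigma> r] functional_scale[OF linear_sintegral, of g b \<tau> r]
      by (simp add: distrib_left)
  qed
  show "bounded_continuous_functional (\<lambda>f. sintegral \<sigma> f + sintegral \<tau> f)"
    unfolding bounded_continuous_functional_def
  proof (safe, goal_cases)
    case (1 u g b)
    then show ?case
      by (intro tendsto_add functional_lim[OF continuous_sintegral, where B = b]) auto
  qed
qed (simp add: sintegral_indicator)

lemma sintegral_scale_measure:
  assumes "f \<in> borel_measurable borel" "\<And>x. \<bar>f x\<bar> \<le> B"
  shows "sintegral (r *\<^sub>R \<sigma>) f = r * sintegral \<sigma> f"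
proof (rule sintegral_eqI[OF _ _ _ assms])
  show "linear_on_bounded_borel (\<lambda>f. r * sintegral \<sigma> f)"
    unfolding linear_on_bounded_borel_def
  proof (safe, goal_cases)
    case (1 g h b)
    then show ?case
      using functional_add[OF linear_sintegral, of g h b b \<sigma>] by (simp add: distrib_left)
  next
    case (2 g b s)
    then show ?case
      using functional_scale[OF linear_sintegral, of g b \<sigma> s] by simp
  qed
  show "bounded_continuous_functional (\<lambda>f. r * sintegral \<sigma> f)"
    unfolding bounded_continuous_functional_def
  proof (safe, goal_cases)
    case (1 u g b)
    then show ?case
      by (intro tendsto_mult_left functional_lim[OF continuous_sintegral, where B = b]) auto
  qed
qed (simp add: sintegral_indicator)

lemma sintegral_restr:
  fixes f :: "'a::topological_space \<Rightarrow> real"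
  assumes A [measurable]: "A \<in> sets borel"
    and f: "f \<in> borel_measurable borel" "\<And>x. \<bar>f x\<bar> \<le> B"
  shows "sintegral (restr A \<sigma>) f = sintegral \<sigma> (\<lambda>x. indicator A x * f x)"
proof (rule sintegral_eqI[OF _ _ _ f])
  have bd: "\<bar>indicator A x * g x\<bar> \<le> b" if "\<forall>x. \<bar>g x\<bar> \<le> b" for g and x :: 'a and b :: real
    using that by (auto simp: indicator_def intro: order_trans[OF abs_ge_zero])
  show "linear_on_bounded_borel (\<lambda>f. sintegral \<sigma> (\<lambda>x. indicator A x * f x))"
    unfolding linear_on_bounded_borel_def
  proof (safe, goal_cases)
    case (1 g h b)
    then show ?case
      using functional_add[OF linear_sintegral, of "\<lambda>x. indicator A x * g x" "\<lambda>x. indicator A x * h x" b b \<sigma>]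
        bd[of g b] bd[of h b] by (simp add: algebra_simps)
  next
    case (2 g b r)
    then show ?case
      using functional_scale[OF linear_sintegral, of "\<lambda>x. indicator A x * g x" b \<sigma> r] bd[of g b]
      by (simp add: algebra_simps)
  qed
  show "bounded_continuous_functional (\<lambda>f. sintegral \<sigma> (\<lambda>x. indicator A x * f x))"
    unfolding bounded_continuous_functional_def
  proof (safe, goal_cases)
    case (1 u g b)
    then show ?case
      by (intro functional_lim[OF continuous_sintegral, where B = b]) (auto intro!: tendsto_mult_left bd borel_measurable_times)
  qed
  show "sintegral \<sigma> (\<lambda>x. indicator A x * indicator E x) = smeasure (restr A \<sigma>) E"
    if "E \<in> sets borel" for E
    using that sintegral_indicator[of "A \<inter> E" \<sigma>] by (simp add: indicator_inter_arith[abs_def])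
qed

lemma sintegral_const: "sintegral \<sigma> (\<lambda>_. r) = r * smeasure \<sigma> UNIV"
  using sintegral_indicator[of UNIV \<sigma>] functional_scale[OF linear_sintegral, of "\<lambda>_. 1" 1 \<sigma> r] by simp

lemma sintegral_sum:
  fixes f :: "'i \<Rightarrow> 'a::topological_space \<Rightarrow> real"
  assumes "finite I" "\<And>i. i \<in> I \<Longrightarrow> f i \<in> borel_measurable borel" "\<And>i x. i \<in> I \<Longrightarrow> \<bar>f i x\<bar> \<le> B"
  shows "sintegral \<sigma> (\<lambda>x. \<Sum>i\<in>I. f i x) = (\<Sum>i\<in>I. sintegral \<sigma> (f i))"
  using assms
proof (induction I rule: finite_induct)
  case empty
  then show ?case by (simp add: sintegral_const)
next
  case (insert i I)
  have "\<bar>\<Sum>i\<in>I. f i x\<bar> \<le> of_nat (card I) * B" for x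
    using insert.prems by (intro order_trans[OF sum_abs] sum_bounded_above) auto
  from functional_add[OF linear_sintegral, of "f i" "\<lambda>x. \<Sum>i\<in>I. f i x" B _ \<sigma>, OF _ _ _ this] insert
  show ?case by simp
qed

text \<open>Each of the two Jordan parts has mass at most the total variation, hence the factor 2.
  Any constant suffices for continuity in total variation.\<close>

lemma abs_sintegral_le:
  assumes f: "f \<in> borel_measurable borel" "\<And>x. \<bar>f x\<bar> \<le> B"
  shows "\<bar>sintegral \<sigma> f\<bar> \<le> norm \<sigma> * (2 * B)"
proof -
  have B: "0 \<le> B" using f(2) abs_ge_zero order_trans by blast
  have *: "\<bar>integral\<^sup>L (pos_part \<tau>) f\<bar> \<le> B * norm \<tau>" for \<tau> :: "'a signed_measure"
  proof -
    interpret finite_measure "pos_part \<tau>" by (rule finite_measure_pos_part)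
    have int: "integrable (pos_part \<tau>) f"
      by (rule integrable_bounded_borel[OF finite_measure_pos_part _ f]) simp
    have "\<bar>integral\<^sup>L (pos_part \<tau>) f\<bar> \<le> (\<integral>x. B \<partial>pos_part \<tau>)"
      using f(2) int by (intro integral_abs_bound[THEN order_trans] integral_mono) auto
    also have "\<dots> = B * upper_variation \<tau> UNIV"
      by (simp add: measure_def emeasure_pos_part upper_variation_nonneg)
    also have "\<dots> \<le> B * norm \<tau>"
      using abs_smeasure_le_tv[of \<tau>] B
      by (intro mult_left_mono upper_variation_le) (auto simp: norm_signed_measure_def abs_le_iff)
    finally show ?thesis .
  qed
  show ?thesis
    using *[of \<sigma>] *[of "- \<sigma>"] unfolding sintegral_def neg_part_def norm_minus_cancel
    by (simp add: algebra_simps abs_le_iff)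
qed

lemma bounded_linear_sintegral:
  assumes "f \<in> borel_measurable borel" "\<And>x. \<bar>f x\<bar> \<le> B"
  shows "bounded_linear (\<lambda>\<sigma>. sintegral \<sigma> f)"
  using sintegral_add_measure[OF assms] sintegral_scale_measure[OF assms] abs_sintegral_le[OF assms]
  by (intro bounded_linear_intro[where K = "2 * B"]) auto

section \<open>Nonnegative signed measures\<close>

lemma smeasure_nonneg: "0 \<le> \<sigma> \<Longrightarrow> 0 \<le> smeasure \<sigma> A"
  by (cases "A \<in> sets borel") (auto simp: less_eq_signed_measure_def smeasure_not_borel)

lemma smeasure_mono:
  assumes "0 \<le> \<sigma>" "A \<subseteq> B" "A \<in> sets borel" "B \<in> sets borel"
  shows "smeasure \<sigma> A \<le> smeasure \<sigma> B"
  using smeasure_Diff[OF assms(4,3,2), of \<sigma>] smeasure_nonneg[OF assms(1), of "B - A"] by simp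

text \<open>All values of \<open>- \<sigma>\<close> are at most 0, so its upper variation vanishes
  and the Jordan decomposition reduces to the positive part.\<close>

lemma measure_pos_part:
  assumes "0 \<le> \<sigma>" "A \<in> sets borel"
  shows "measure (pos_part \<sigma>) A = smeasure \<sigma> A"
proof -
  have "upper_variation (- \<sigma>) A = 0"
    using smeasure_nonneg[OF assms(1)]
    by (intro antisym upper_variation_nonneg upper_variation_le) simp
  then show ?thesis
    using assms by (simp add: jordan_decomposition neg_part_def measure_def emeasure_pos_part)
qed

lemma sintegral_pos:
  assumes "0 \<le> \<sigma>" "f \<in> borel_measurable borel" "\<And>x. \<bar>f x\<bar> \<le> B"
  shows "sintegral \<sigma> f = integral\<^sup>L (pos_part \<sigma>) f"
  using finite_measure_pos_part[of \<sigma>]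
  by (intro sintegral_eqI[OF linear_integral continuous_integral _ assms(2,3)])
    (auto simp: measure_pos_part assms(1))

lemma sintegral_nonneg:
  assumes "0 \<le> \<sigma>" "f \<in> borel_measurable borel" "\<And>x. \<bar>f x\<bar> \<le> B" "\<And>x. 0 \<le> f x"
  shows "0 \<le> sintegral \<sigma> f"
  unfolding sintegral_pos[OF assms(1-3)] using assms(4) by simp

text \<open>By additivity every partition sum equals the total mass. This turns equality of norms
  into equality of masses.\<close>

lemma norm_nonneg_signed_measure:
  assumes "0 \<le> \<sigma>"
  shows "norm \<sigma> = smeasure \<sigma> UNIV"
proof (rule antisym)
  show "norm \<sigma> \<le> smeasure \<sigma> UNIV"
    unfolding norm_signed_measure_def
  proof (rule tv_le)
    fix P :: "'a set set" assume P: "borel_partition P"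
    have "(\<Sum>A\<in>P. \<bar>smeasure \<sigma> A\<bar>) = (\<Sum>A\<in>P. smeasure \<sigma> A)"
      using smeasure_nonneg[OF assms] by simp
    also have "\<dots> = smeasure \<sigma> UNIV"
      using P smeasure_Union[of P \<sigma>] by (simp add: borel_partition_def)
    finally show "(\<Sum>A\<in>P. \<bar>smeasure \<sigma> A\<bar>) \<le> smeasure \<sigma> UNIV" by simp
  qed
  show "smeasure \<sigma> UNIV \<le> norm \<sigma>"
    using abs_smeasure_le_tv[of \<sigma> UNIV] by (simp add: norm_signed_measure_def)
qed

section \<open>Simple Markov transfunctions from partitions of unity\<close>

text \<open>Tent functions on finitely many balls of radius \<open>\<delta> / 2\<close> covering
  \<open>K\<close> are normalised, and one further function accounts for the rest of the space. The
  bounds hold for all indices, so later arguments need no index range.\<close>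

lemma small_partition_of_unity:
  fixes K :: "'a::metric_space set"
  assumes "compact K" "0 < \<delta>"
  obtains m :: nat and f :: "nat \<Rightarrow> 'a \<Rightarrow> real"
  where "\<And>i. continuous_on UNIV (f i)" "\<And>i x. 0 \<le> f i x" "\<And>i x. f i x \<le> 1"
    "\<And>x. (\<Sum>i=1..m. f i x) = 1"
    "\<And>i x y. x \<in> K \<Longrightarrow> y \<in> K \<Longrightarrow> f i x \<noteq> 0 \<Longrightarrow> f i y \<noteq> 0 \<Longrightarrow> dist x y < \<delta>"
proof -
  obtain F where F: "finite F" "K \<subseteq> (\<Union>a\<in>F. ball a (\<delta> / 2))"
    using assms by (metis compactE_image[of K UNIV "\<lambda>a. ball a (\<delta> / 2)"] UNIV_I UN_I centre_in_ball half_gt_zero open_ball subsetI)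
  obtain n and a :: "nat \<Rightarrow> 'a" where a: "bij_betw a {1..n} F"
    using ex_bij_betw_nat_finite_1[OF F(1)] by blast
  define g where "g i x = (if i \<in> {1..n} then max 0 (\<delta> / 2 - dist (a i) x) else 0)" for i x
  define s where "s x = (\<Sum>i=1..n. g i x)" for x
  have g0: "0 \<le> g i x" for i x by (simp add: g_def)
  have contg: "continuous_on UNIV (g i)" for i
    unfolding g_def by (cases "i \<in> {1..n}") (auto intro!: continuous_intros)
  have conts: "continuous_on UNIV s"
    unfolding s_def using contg by (intro continuous_intros)
  have s0: "0 \<le> s x" for x by (simp add: s_def sum_nonneg g0)
  have gs: "g i x \<le> s x" for i x
  proof (cases "i \<in> {1..n}")
    case True
    then show ?thesis unfolding s_def using g0 by (intro member_le_sum) auto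
  next
    case False
    then have "g i x = 0" by (simp only: g_def if_False)
    then show ?thesis using s0[of x] by simp
  qed
  have spos: "0 < s x" if "x \<in> K" for x
  proof -
    obtain y where "y \<in> F" "dist y x < \<delta> / 2"
      using F(2) \<open>x \<in> K\<close> by auto
    then obtain i where i: "i \<in> {1..n}" "dist (a i) x < \<delta> / 2"
      using a by (metis bij_betw_imp_surj_on imageE)
    then have "0 < g i x" by (simp add: g_def)
    with gs[of i x] show ?thesis by simp
  qed
  \<comment> \<open>By compactness \<open>s\<close> has a positive minimum on \<open>K\<close>.
    Dividing by \<open>max r (s x)\<close> is then division by \<open>s x\<close> on
    \<open>K\<close> and is safe elsewhere. An empty \<open>K\<close> has no minimum, and
    \<open>1\<close> serves instead.\<close>
  obtain r where r: "0 < r" "\<And>x. x \<in> K \<Longrightarrow> r \<le> s x"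
  proof (cases "K = {}")
    case False
    then obtain y where "y \<in> K" "\<And>x. x \<in> K \<Longrightarrow> s y \<le> s x"
      using continuous_attains_inf[OF assms(1) False continuous_on_subset[OF conts]] by auto
    then show ?thesis using that spos by blast
  qed (use that[of 1] in auto)
  \<comment> \<open>The member with index \<open>Suc n\<close> makes the sum one off \<open>K\<close> and vanishes on \<open>K\<close>.\<close>
  define f where "f i x = (if i = Suc n then max 0 (r - s x) else g i x) / max r (s x)" for i x
  have den: "0 < max r (s x)" for x using r by auto
  have rest: "f (Suc n) x = 0" if "x \<in> K" for x using r(2)[OF that] by (simp add: f_def)
  show thesis
  proof (rule that[of f "Suc n"])
    show "continuous_on UNIV (f i)" for i
      unfolding f_def using den contg[of i] conts
      by (cases "i = Suc n") (auto intro!: continuous_intros simp: less_imp_neq[OF den, symmetric])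
    show "0 \<le> f i x" for i x
      using den[of x] g0[of i x] by (simp add: f_def)
    show "f i x \<le> 1" for i x
      using den[of x] gs[of i x] s0[of x] by (auto simp: f_def)
    show "(\<Sum>i=1..Suc n. f i x) = 1" for x
    proof -
      have "(\<Sum>i=1..n. f i x) = s x / max r (s x)"
        by (simp add: f_def s_def sum_divide_distrib)
      then have "(\<Sum>i=1..Suc n. f i x) = (s x + max 0 (r - s x)) / max r (s x)"
        by (simp add: f_def add_divide_distrib)
      also have "s x + max 0 (r - s x) = max r (s x)" by auto
      finally show ?thesis using den[of x] by simp
    qed
    show "dist x y < \<delta>" if "x \<in> K" "y \<in> K" "f i x \<noteq> 0" "f i y \<noteq> 0" for i x y
    proof -
      \<comment> \<open>The further function vanishes on \<open>K\<close>, so \<open>i\<close>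
        belongs to a tent, and both points lie in its ball of radius
        \<open>\<delta> / 2\<close>.\<close>
      have "i \<noteq> Suc n" using rest that by auto
      then have "dist (a i) x < \<delta> / 2" "dist (a i) y < \<delta> / 2"
        using that by (auto simp: f_def g_def max_def split: if_splits)
      then show ?thesis by metric
    qed
  qed
qed

section \<open>Markov transfunctions from partitions, and integrals against marginals\<close>

definition signed_of :: "'a::topological_space measure \<Rightarrow> 'a signed_measure" where
  "signed_of M = Abs_signed_measure (\<lambda>A. if A \<in> sets borel then measure M A else 0)"

lemma smeasure_signed_of:
  assumes "finite_measure M" "sets M = sets borel" "A \<in> sets borel"
  shows "smeasure (signed_of M) A = measure M A"
proof -
  have "(\<lambda>A. if A \<in> sets borel then measure M A else 0) \<in> {\<mu>. signed_borel \<mu>}"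
    using finite_measure.finite_measure_UNION[OF assms(1)] assms(2)
    by (auto simp: signed_borel_def image_subset_iff)
  then show ?thesis using assms(3) by (simp add: signed_of_def Abs_signed_measure_inverse)
qed

lemma restr_UNIV: "restr UNIV \<sigma> = \<sigma>"
  by (rule smeasure_eqI) simp

lemma smeasure_sum: "smeasure (\<Sum>i\<in>I. \<sigma> i) A = (\<Sum>i\<in>I. smeasure (\<sigma> i) A)"
  by (induction I rule: infinite_finite_induct) auto

locale continuous_partition =
  fixes m :: nat and f :: "nat \<Rightarrow> 'a::topological_space \<Rightarrow> real"
  assumes cont: "\<And>i. continuous_on UNIV (f i)"
    and nonneg: "\<And>i x. 0 \<le> f i x" and le_one: "\<And>i x. f i x \<le> 1"
    and sum_one: "\<And>x. (\<Sum>i=1..m. f i x) = 1"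
begin

lemma abs_le_one: "\<bar>f i x\<bar> \<le> 1"
  using nonneg[of i x] le_one[of i x] by simp

lemma borel_measurable_partition [measurable]: "f i \<in> borel_measurable borel"
  using cont by (rule borel_measurable_continuous_onI)

text \<open>Positivity comes from that of \<open>f i\<close> and \<open>R i\<close>, preservation of
  mass from \<open>sum_one\<close> and the unit masses of the \<open>R i\<close>, and continuity
  from writing the map as a finite sum of bounded linear maps.\<close>

lemma simple_markov_transfunction:
  assumes R: "\<And>i. 0 \<le> R i" "\<And>i. smeasure (R i) UNIV = 1"
  defines "\<Phi> \<equiv> \<lambda>\<sigma>. \<Sum>i=1..m. sintegral \<sigma> (f i) *\<^sub>R R i"
  shows "simple_transfunction \<Phi>" "markov_transfunction \<Phi>"
proof -
  have "f i \<in> bcontfun" for i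
    using cont abs_le_one by (auto simp: bcontfun_def bounded_iff)
  then show "simple_transfunction \<Phi>"
    unfolding simple_transfunction_def \<Phi>_def by blast
  have "bounded_linear \<Phi>"
    unfolding \<Phi>_def
    by (intro bounded_linear_sum bounded_linear_scaleR_left[THEN bounded_linear_compose]
        bounded_linear_sintegral[OF borel_measurable_partition abs_le_one])
  moreover have "0 \<le> \<Phi> \<sigma>" if "0 \<le> \<sigma>" for \<sigma>
    unfolding less_eq_signed_measure_def \<Phi>_def
    using sintegral_nonneg[OF that borel_measurable_partition abs_le_one nonneg] smeasure_nonneg[OF R(1)]
    by (auto simp: smeasure_sum intro!: sum_nonneg)
  moreover have "smeasure (\<Phi> \<sigma>) UNIV = smeasure \<sigma> UNIV" for \<sigma>
    using sintegral_sum[of "{1..m}" f 1 \<sigma>] abs_le_one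
    by (simp add: \<Phi>_def smeasure_sum R sum_one sintegral_const del: One_nat_def)
  ultimately show "markov_transfunction \<Phi>"
    unfolding markov_transfunction_def
    by (auto intro: bounded_linear.linear linear_continuous_on)
qed

end

text \<open>The image of \<open>\<pi>\<close> under \<open>fst\<close> agrees with
  \<open>\<mu>\<close> on Borel sets, so integrals against \<open>\<mu>\<close> can be carried out
  on the plan.\<close>

lemma sintegral_plan:
  fixes f :: "'a::topological_space \<Rightarrow> real"
  assumes \<pi>: "\<pi> \<in> plans \<mu> \<rho>" and f: "f \<in> borel_measurable borel" "\<And>x. \<bar>f x\<bar> \<le> B"
  shows "sintegral \<mu> f = (\<integral>z. f (fst z) \<partial>\<pi>)"
proof -
  have s [measurable_cong]: "sets \<pi> = sets borel" and fin: "finite_measure \<pi>"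
    and marg: "\<And>A. A \<in> sets borel \<Longrightarrow> measure \<pi> (A \<times> UNIV) = smeasure \<mu> A"
    using \<pi> by (auto simp: plans_def)
  have sp: "space \<pi> = UNIV" using sets_eq_imp_space_eq[OF s] by simp
  have fst [measurable]: "fst \<in> borel_measurable \<pi>"
    by (auto simp: measurable_cong_sets[OF s refl] intro!: borel_measurable_continuous_onI continuous_intros)
  have v: "fst -` A = A \<times> (UNIV :: 'a set)" for A :: "'a set" by auto
  have "sintegral \<mu> f = integral\<^sup>L (distr \<pi> borel fst) f"
  proof (rule sintegral_eqI[OF linear_integral continuous_integral _ f])
    show "integral\<^sup>L (distr \<pi> borel fst) (indicator A) = smeasure \<mu> A" if "A \<in> sets borel" for A
      using that by (simp add: measure_distr[OF fst] sp v marg)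
  qed (auto intro!: finite_measure.finite_measure_distr fin)
  also have "\<dots> = (\<integral>z. f (fst z) \<partial>\<pi>)" by (rule integral_distr[OF fst f(1)])
  finally show ?thesis .
qed


lemma plan_measurable:
  fixes \<mu> \<rho> :: "'a::second_countable_topology signed_measure"
  assumes "\<pi> \<in> plans \<mu> \<rho>"
  shows "fst \<in> borel_measurable \<pi>" "snd \<in> borel_measurable \<pi>" "space \<pi> = UNIV"
  using assms sets_eq_imp_space_eq[of \<pi> borel]
  by (auto simp: plans_def measurable_cong_sets[of \<pi> borel borel borel]
      intro!: borel_measurable_continuous_onI continuous_intros)

section \<open>The transfunction built from a plan and a partition of unity\<close>

locale partitioned_plan = continuous_partition m f
  for m :: nat and f :: "nat \<Rightarrow> 'a::polish_space \<Rightarrow> real" +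
  fixes \<mu> \<rho> :: "'a signed_measure" and \<pi> :: "('a \<times> 'a) measure"
  assumes plan: "\<pi> \<in> plans \<mu> \<rho>"
begin

sublocale finite_measure \<pi>
  using plan by (simp add: plans_def)

lemma sets_plan [measurable_cong]: "sets \<pi> = sets borel"
  using plan by (simp add: plans_def)

lemmas plan_measurable_fst [measurable] = plan_measurable(1)[OF plan]
lemmas plan_measurable_snd [measurable] = plan_measurable(2)[OF plan]
lemmas space_plan [simp] = plan_measurable(3)[OF plan]

lemma integrable_partition:
  assumes [measurable]: "g \<in> borel_measurable \<pi>" and "\<And>z. \<bar>g z\<bar> \<le> 1"
  shows "integrable \<pi> (\<lambda>z. f i (fst z) * g z)"
proof (rule integrable_const_bound[of _ 1])
  show "AE z in \<pi>. norm (f i (fst z) * g z) \<le> 1"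
    using assms(2) nonneg le_one by (auto simp: abs_mult intro!: mult_le_one)
qed measurable

text \<open>By \<open>sintegral_plan\<close> this is the integral of \<open>f i\<close> against
  \<open>\<mu>\<close>, that is \<open>a\<^sub>i\<close>.\<close>

definition mass :: "nat \<Rightarrow> real" where
  "mass i = (\<integral>z. f i (fst z) \<partial>\<pi>)"

text \<open>If \<open>mass i = 0\<close>, any probability measure would do; the point mass keeps \<open>\<Phi>\<close> Markov.\<close>

definition target :: "nat \<Rightarrow> 'a signed_measure" where
  "target i = signed_of (if mass i = 0 then distr (count_space {()}) borel (\<lambda>_. undefined)
     else distr (density \<pi> (\<lambda>z. ennreal (f i (fst z) / mass i))) borel snd)"

text \<open>The image of the one-point counting measure under a constant map is the point mass at
  \<open>undefined\<close>.\<close>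

lemma finite_point_mass: "finite_measure (distr (count_space {()}) borel (\<lambda>_. undefined))"
  by (intro finite_measure.finite_measure_distr finite_measure_count_space) auto

definition transfun :: "'a transfunction" where
  "transfun \<sigma> = (\<Sum>i=1..m. sintegral \<sigma> (f i) *\<^sub>R target i)"

lemma mass_nonneg: "0 \<le> mass i"
  by (simp add: mass_def nonneg)

lemma smeasure_target:
  assumes "mass i \<noteq> 0" and [measurable]: "B \<in> sets borel"
  shows "smeasure (target i) B = (\<integral>z. f i (fst z) * indicator B (snd z) \<partial>\<pi>) / mass i"
proof -
  let ?N = "distr (density \<pi> (\<lambda>z. ennreal (f i (fst z) / mass i))) borel snd"
  have em: "emeasure ?N C = ennreal ((\<integral>z. f i (fst z) * indicator C (snd z) \<partial>\<pi>) / mass i)"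
    if [measurable]: "C \<in> sets borel" for C
  proof -
    have "emeasure ?N C = (\<integral>\<^sup>+z. ennreal (f i (fst z) * indicator C (snd z) / mass i) \<partial>\<pi>)"
      using measurable_sets[OF plan_measurable_snd that]
      by (auto simp: emeasure_distr emeasure_density intro!: nn_integral_cong split: split_indicator)
    also have "\<dots> = ennreal (\<integral>z. f i (fst z) * indicator C (snd z) / mass i \<partial>\<pi>)"
      using nonneg mass_nonneg
      by (intro nn_integral_eq_integral integrable_divide integrable_partition) auto
    finally show ?thesis by simp
  qed
  have "finite_measure ?N" by (rule finite_measureI) (simp add: em)
  then show ?thesis
    using assms nonneg mass_nonneg
    by (simp add: target_def smeasure_signed_of measure_def em)
qed

lemma target_nonneg: "0 \<le> target i"
  unfolding less_eq_signed_measure_def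
proof safe
  fix B :: "'a set" assume B: "B \<in> sets borel"
  show "smeasure 0 B \<le> smeasure (target i) B"
  proof (cases "mass i = 0")
    case True
    then show ?thesis
      using B by (simp add: target_def smeasure_signed_of finite_point_mass)
  next
    case False
    then show ?thesis
      using B nonneg mass_nonneg by (simp add: smeasure_target)
  qed
qed

lemma target_UNIV: "smeasure (target i) UNIV = 1"
proof (cases "mass i = 0")
  case True
  then show ?thesis
    by (simp add: target_def smeasure_signed_of finite_point_mass measure_def emeasure_distr)
next
  case False
  then show ?thesis by (simp add: smeasure_target) (simp add: mass_def)
qed

lemma transfun_simple_markov: "simple_transfunction transfun" "markov_transfunction transfun"
  using simple_markov_transfunction[OF target_nonneg target_UNIV] unfolding transfun_def[abs_def] by auto

text \<open>These are the values that the plan of \<open>transfun\<close> must take on rectangles;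
  \<open>emeasure_glue\<close> finds the same values for \<open>glue\<close>.\<close>

lemma transfun_restr:
  assumes [measurable]: "A \<in> sets borel" "B \<in> sets borel"
  shows "smeasure (transfun (restr A \<mu>)) B =
    (\<Sum>i=1..m. (\<integral>z. f i (fst z) * indicator A (fst z) \<partial>\<pi>) *
       (\<integral>z. f i (fst z) * indicator B (snd z) \<partial>\<pi>) / mass i)"
  unfolding transfun_def smeasure_sum
proof (rule sum.cong[OF refl])
  fix i
  have bd: "\<bar>indicator A x * f i x\<bar> \<le> 1" for x
    using abs_le_one[of i x] by (auto split: split_indicator)
  have "sintegral (restr A \<mu>) (f i) = sintegral \<mu> (\<lambda>x. indicator A x * f i x)"
    by (rule sintegral_restr[OF assms(1) borel_measurable_partition abs_le_one])
  also have "\<dots> = (\<integral>z. f i (fst z) * indicator A (fst z) \<partial>\<pi>)"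
    using sintegral_plan[OF plan _ bd] by (simp add: mult.commute)
  finally have A: "sintegral (restr A \<mu>) (f i) = (\<integral>z. f i (fst z) * indicator A (fst z) \<partial>\<pi>)" .
  show "smeasure (sintegral (restr A \<mu>) (f i) *\<^sub>R target i) B =
    (\<integral>z. f i (fst z) * indicator A (fst z) \<partial>\<pi>) *
    (\<integral>z. f i (fst z) * indicator B (snd z) \<partial>\<pi>) / mass i"
  proof (cases "mass i = 0")
    case True
    \<comment> \<open>The right side of the goal is zero because \<open>x / 0 = 0\<close>. The left
      side carries the point mass, and its coefficient is squeezed between 0 and
      \<open>mass i\<close>.\<close>
    have "(\<integral>z. f i (fst z) * indicator A (fst z) \<partial>\<pi>) \<le> (\<integral>z. f i (fst z) * 1 \<partial>\<pi>)"
      using nonneg by (intro integral_mono integrable_partition mult_left_mono) (auto split: split_indicator)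
    moreover have "0 \<le> (\<integral>z. f i (fst z) * indicator A (fst z) \<partial>\<pi>)"
      using nonneg by simp
    ultimately have "(\<integral>z. f i (fst z) * indicator A (fst z) \<partial>\<pi>) = 0"
      using True by (simp add: mass_def)
    then show ?thesis using A by simp
  next
    case False
    then show ?thesis by (simp add: A smeasure_target)
  qed
qed

text \<open>For \<open>A = UNIV\<close> the first factor in \<open>transfun_restr\<close> is
  \<open>mass i\<close> and cancels. Since the \<open>f i\<close> sum to one, the second marginal of
  \<open>\<pi>\<close> remains.\<close>

lemma transfun_marginal: "transfun \<mu> = \<rho>"
proof (rule smeasure_eqI)
  fix B :: "'a set" assume B [measurable]: "B \<in> sets borel"
  \<comment> \<open>The cancellation of \<open>mass i\<close> breaks down at zero; there the summand
    itself must vanish.\<close>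
  have null: "(\<integral>z. f i (fst z) * indicator B (snd z) \<partial>\<pi>) = 0" if "mass i = 0" for i
  proof -
    have "(\<integral>z. f i (fst z) * indicator B (snd z) \<partial>\<pi>) \<le> (\<integral>z. f i (fst z) * 1 \<partial>\<pi>)"
      using nonneg by (intro integral_mono integrable_partition mult_left_mono) (auto split: split_indicator)
    moreover have "0 \<le> (\<integral>z. f i (fst z) * indicator B (snd z) \<partial>\<pi>)"
      using nonneg by simp
    ultimately show ?thesis using that by (simp add: mass_def)
  qed
  have "smeasure (transfun \<mu>) B =
      (\<Sum>i=1..m. mass i * (\<integral>z. f i (fst z) * indicator B (snd z) \<partial>\<pi>) / mass i)"
    using transfun_restr[of UNIV B] by (simp add: restr_UNIV mass_def)
  also have "\<dots> = (\<Sum>i=1..m. \<integral>z. f i (fst z) * indicator B (snd z) \<partial>\<pi>)"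
    by (rule sum.cong) (auto simp: null)
  also have "\<dots> = (\<integral>z. (\<Sum>i=1..m. f i (fst z) * indicator B (snd z)) \<partial>\<pi>)"
    by (intro Bochner_Integration.integral_sum[symmetric] integrable_partition) (auto split: split_indicator)
  also have "\<dots> = (\<integral>z. indicator (UNIV \<times> B) z \<partial>\<pi>)"
    by (simp add: sum_distrib_right[symmetric] sum_one indicator_times del: One_nat_def)
  also have "\<dots> = smeasure \<rho> B"
    using plan B by (simp add: plans_def)
  finally show "smeasure (transfun \<mu>) B = smeasure \<rho> B" .
qed

section \<open>The glued plan, its marginals and its cost\<close>

text \<open>Summands with \<open>mass i = 0\<close> vanish because \<open>x / 0 = 0\<close>, so the weight may integrate to less
  than \<open>1\<close> at a null set of points \<open>z'\<close>.\<close>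

definition weight :: "'a \<times> 'a \<Rightarrow> 'a \<times> 'a \<Rightarrow> real" where
  "weight z z' = (\<Sum>i=1..m. f i (fst z) * f i (fst z') / mass i)"

definition glue :: "('a \<times> 'a) measure" where
  "glue = distr (density (\<pi> \<Otimes>\<^sub>M \<pi>) (\<lambda>(z, z'). ennreal (weight z z'))) borel (\<lambda>(z, z'). (fst z, snd z'))"

lemma measurable_weight [measurable]: "(\<lambda>(z, z'). weight z z') \<in> borel_measurable (\<pi> \<Otimes>\<^sub>M \<pi>)"
  unfolding weight_def by measurable

lemma measurable_fst_snd [measurable]: "(\<lambda>(z, z'). (fst z, snd z')) \<in> borel_measurable (\<pi> \<Otimes>\<^sub>M \<pi>)"
  unfolding borel_prod[symmetric] by measurable

text \<open>The inner integral runs over the first copy of \<open>\<pi>\<close>, so that for fixed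
  \<open>z'\<close> the weight can be integrated out.\<close>

lemma nn_integral_glue:
  assumes [measurable]: "h \<in> borel_measurable borel"
  shows "(\<integral>\<^sup>+x. h x \<partial>glue) = (\<integral>\<^sup>+z'. \<integral>\<^sup>+z. ennreal (weight z z') * h (fst z, snd z') \<partial>\<pi> \<partial>\<pi>)"
proof -
  interpret pair_sigma_finite \<pi> \<pi> ..
  have "(\<integral>\<^sup>+x. h x \<partial>glue) = (\<integral>\<^sup>+(z, z'). ennreal (weight z z') * h (fst z, snd z') \<partial>(\<pi> \<Otimes>\<^sub>M \<pi>))"
    unfolding glue_def
    by (subst nn_integral_distr, measurable, subst nn_integral_density)
      (measurable, auto intro!: nn_integral_cong)
  also have "\<dots> = (\<integral>\<^sup>+z'. \<integral>\<^sup>+z. ennreal (weight z z') * h (fst z, snd z') \<partial>\<pi> \<partial>\<pi>)"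
    by (subst nn_integral_snd[symmetric]) auto
  finally show ?thesis .
qed

text \<open>Integrating out \<open>z\<close> turns \<open>f i (fst z)\<close> into
  \<open>mass i\<close>, which cancels or leaves a zero summand. An upper bound is enough for the
  cost estimate.\<close>

lemma nn_integral_weight_le: "(\<integral>\<^sup>+z. ennreal (weight z z') \<partial>\<pi>) \<le> 1"
proof -
  have "(\<integral>\<^sup>+z. ennreal (weight z z') \<partial>\<pi>) = ennreal (\<integral>z. weight z z' \<partial>\<pi>)"
    unfolding weight_def
    using integrable_partition[of "\<lambda>_. 1"] nonneg mass_nonneg
    by (intro nn_integral_eq_integral Bochner_Integration.integrable_sum integrable_divide integrable_mult_left)
      (auto intro!: sum_nonneg)
  moreover have "(\<integral>z. weight z z' \<partial>\<pi>) = (\<Sum>i=1..m. mass i * f i (fst z') / mass i)"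
    unfolding weight_def mass_def
    using integrable_partition[of "\<lambda>_. 1"]
    by (subst Bochner_Integration.integral_sum) auto
  moreover have "(\<Sum>i=1..m. mass i * f i (fst z') / mass i) \<le> (\<Sum>i=1..m. f i (fst z'))"
    using nonneg by (intro sum_mono) auto
  ultimately show ?thesis by (simp add: sum_one ennreal_le_1 del: One_nat_def)
qed

text \<open>On a rectangle the integrand is a finite sum of products of a function of
  \<open>z\<close> and a function of \<open>z'\<close>, so the double integral factors.\<close>

lemma emeasure_glue:
  assumes [measurable]: "A \<in> sets borel" "B \<in> sets borel"
  shows "emeasure glue (A \<times> B) = ennreal (smeasure (transfun (restr A \<mu>)) B)"
proof -
  have [simp]: "A \<times> B \<in> sets borel" by (intro borel_Times assms)
  have sg: "sets glue = sets borel" by (simp add: glue_def)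
  have "emeasure glue (A \<times> B) = (\<integral>\<^sup>+x. indicator (A \<times> B) x \<partial>glue)"
    by (simp add: sg)
  also have "\<dots> = (\<integral>\<^sup>+z'. \<integral>\<^sup>+z. ennreal (weight z z') * indicator (A \<times> B) (fst z, snd z') \<partial>\<pi> \<partial>\<pi>)"
    by (intro nn_integral_glue borel_measurable_indicator) simp
  also have "\<dots> = (\<integral>\<^sup>+z'. \<integral>\<^sup>+z. (\<Sum>i=1..m. ennreal (f i (fst z) * indicator A (fst z)) *
      ennreal (f i (fst z') * indicator B (snd z') / mass i)) \<partial>\<pi> \<partial>\<pi>)"
    using nonneg mass_nonneg
    by (intro nn_integral_cong)
      (auto simp: weight_def sum_ennreal ennreal_mult[symmetric] split: split_indicator)
  also have "\<dots> = (\<Sum>i=1..m. (\<integral>\<^sup>+z. ennreal (f i (fst z) * indicator A (fst z)) \<partial>\<pi>) *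
      (\<integral>\<^sup>+z'. ennreal (f i (fst z') * indicator B (snd z') / mass i) \<partial>\<pi>))"
    by (simp add: nn_integral_sum nn_integral_cmult nn_integral_multc)
  also have "\<dots> = (\<Sum>i=1..m. ennreal (\<integral>z. f i (fst z) * indicator A (fst z) \<partial>\<pi>) *
      ennreal ((\<integral>z. f i (fst z) * indicator B (snd z) \<partial>\<pi>) / mass i))"
  proof (rule sum.cong[OF refl])
    fix i
    have "(\<integral>\<^sup>+z. ennreal (f i (fst z) * indicator A (fst z)) \<partial>\<pi>) = ennreal (\<integral>z. f i (fst z) * indicator A (fst z) \<partial>\<pi>)"
      using nonneg
      by (intro nn_integral_eq_integral integrable_partition) (auto split: split_indicator)
    moreover have "(\<integral>\<^sup>+z. ennreal (f i (fst z) * indicator B (snd z) / mass i) \<partial>\<pi>) =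
        ennreal (\<integral>z. f i (fst z) * indicator B (snd z) / mass i \<partial>\<pi>)"
      using nonneg mass_nonneg
      by (intro nn_integral_eq_integral integrable_divide integrable_partition) (auto split: split_indicator)
    ultimately show "(\<integral>\<^sup>+z. ennreal (f i (fst z) * indicator A (fst z)) \<partial>\<pi>) *
      (\<integral>\<^sup>+z'. ennreal (f i (fst z') * indicator B (snd z') / mass i) \<partial>\<pi>) =
      ennreal (\<integral>z. f i (fst z) * indicator A (fst z) \<partial>\<pi>) *
      ennreal ((\<integral>z. f i (fst z) * indicator B (snd z) \<partial>\<pi>) / mass i)" by simp
  qed
  also have "\<dots> = ennreal (smeasure (transfun (restr A \<mu>)) B)"
    using nonneg mass_nonneg
    by (simp add: transfun_restr ennreal_mult[symmetric] sum_ennreal)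
  finally show ?thesis .
qed

lemma glue_plan_of: "is_plan_of transfun \<mu> glue" "glue \<in> plans \<mu> \<rho>"
proof -
  \<comment> \<open>Positivity of \<open>\<mu>\<close> is inherited from \<open>\<pi>\<close>, whose
    first marginal it is.\<close>
  have mu: "0 \<le> \<mu>"
    using plan measure_nonneg[of \<pi>] by (auto simp: less_eq_signed_measure_def plans_def) (metis measure_nonneg)
  have restr_nonneg: "0 \<le> restr A \<mu>" if "A \<in> sets borel" for A
    using that smeasure_nonneg[OF mu] by (simp add: less_eq_signed_measure_def)
  have rect: "measure glue (A \<times> B) = smeasure (transfun (restr A \<mu>)) B"
    if "A \<in> sets borel" "B \<in> sets borel" for A B
  proof -
    \<comment> \<open>\<open>ennreal\<close> sends negative numbers to 0, so returning to real
      values needs this sign.\<close>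
    have "0 \<le> transfun (restr A \<mu>)"
      using transfun_simple_markov(2) restr_nonneg[OF that(1)] by (simp add: markov_transfunction_def)
    then show ?thesis
      using that by (simp add: measure_def emeasure_glue smeasure_nonneg)
  qed
  have sg: "sets glue = sets borel" by (simp add: glue_def)
  then have "space glue = UNIV" using sets_eq_imp_space_eq by fastforce
  then have fin: "finite_measure glue"
    using emeasure_glue[of UNIV UNIV] by (intro finite_measureI) simp
  have "measure glue (A \<times> UNIV) = smeasure \<mu> A" if "A \<in> sets borel" for A
    using that rect[of A UNIV] transfun_simple_markov(2) by (simp add: markov_transfunction_def)
  moreover have "measure glue (UNIV \<times> B) = smeasure \<rho> B" if "B \<in> sets borel" for B
    using that rect[of UNIV B] by (simp add: restr_UNIV transfun_marginal)
  ultimately show *: "glue \<in> plans \<mu> \<rho>"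
    using sg fin by (simp add: plans_def)
  show "is_plan_of transfun \<mu> glue"
    using * rect by (simp add: is_plan_of_def transfun_marginal)
qed

text \<open>Where the weight is nonzero, some \<open>f i\<close> is nonzero at both first
  coordinates, so \<open>close\<close> replaces the cost by \<open>c z' + \<eta>\<close>. This no
  longer depends on \<open>z\<close>, and the weight integrates to at most 1.\<close>

lemma glue_cost_le:
  assumes c [measurable]: "c \<in> borel_measurable borel" and "\<And>z. 0 \<le> c z" and "0 \<le> \<eta>"
    and supp: "AE z in \<pi>. fst z \<in> K \<and> snd z \<in> L"
    and close: "\<And>x x' y i. x \<in> K \<Longrightarrow> x' \<in> K \<Longrightarrow> y \<in> L \<Longrightarrow> f i x \<noteq> 0 \<Longrightarrow> f i x' \<noteq> 0 \<Longrightarrow>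
      c (x, y) \<le> c (x', y) + \<eta>"
  shows "(\<integral>\<^sup>+z. ennreal (c z) \<partial>glue) \<le> (\<integral>\<^sup>+z. ennreal (c z + \<eta>) \<partial>\<pi>)"
proof -
  have "(\<integral>\<^sup>+z. ennreal (c z) \<partial>glue) =
      (\<integral>\<^sup>+z'. \<integral>\<^sup>+z. ennreal (weight z z') * ennreal (c (fst z, snd z')) \<partial>\<pi> \<partial>\<pi>)"
    by (rule nn_integral_glue) simp
  also have "\<dots> \<le> (\<integral>\<^sup>+z'. ennreal (c z' + \<eta>) \<partial>\<pi>)"
  proof (rule nn_integral_mono_AE, use supp in eventually_elim)
    case (elim z')
    have "(\<integral>\<^sup>+z. ennreal (weight z z') * ennreal (c (fst z, snd z')) \<partial>\<pi>)
        \<le> (\<integral>\<^sup>+z. ennreal (weight z z') * ennreal (c z' + \<eta>) \<partial>\<pi>)"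
    proof (rule nn_integral_mono_AE, use supp in eventually_elim)
      case z: (elim z)
      show ?case
      proof (cases "weight z z' = 0")
        case False
        then obtain i where "f i (fst z) \<noteq> 0" "f i (fst z') \<noteq> 0"
          unfolding weight_def by (metis (no_types, lifting) div_0 mult_eq_0_iff sum.neutral)
        then have "c (fst z, snd z') \<le> c z' + \<eta>"
          using close[of "fst z" "fst z'" "snd z'" i] z elim by simp
        then show ?thesis by (intro mult_left_mono ennreal_leI) auto
      qed simp
    qed
    also have "\<dots> = (\<integral>\<^sup>+z. ennreal (weight z z') \<partial>\<pi>) * ennreal (c z' + \<eta>)"
      unfolding weight_def by (rule nn_integral_multc) measurable
    also have "\<dots> \<le> 1 * ennreal (c z' + \<eta>)"
      by (intro mult_right_mono nn_integral_weight_le) simp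
    finally show ?case by simp
  qed
  finally show ?thesis .
qed

end

section \<open>Existence and supports of plans\<close>

lemma plans_nonempty:
  fixes \<mu> \<rho> :: "'a::second_countable_topology signed_measure"
  assumes nn: "0 \<le> \<mu>" "0 \<le> \<rho>" and eq: "smeasure \<mu> UNIV = smeasure \<rho> UNIV"
  shows "plans \<mu> \<rho> \<noteq> {}"
proof -
  define t where "t = smeasure \<mu> UNIV"
  \<comment> \<open>The product measure, scaled by the common mass; for \<open>t = 0\<close> the
    factor is 0 and the zero measure results.\<close>
  define \<kappa> where "\<kappa> = scale_measure (ennreal (1 / t)) (pos_part \<mu> \<Otimes>\<^sub>M pos_part \<rho>)"
  interpret M: finite_measure "pos_part \<mu>" by (rule finite_measure_pos_part)
  interpret N: finite_measure "pos_part \<rho>" by (rule finite_measure_pos_part)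
  have t: "0 \<le> t" using smeasure_nonneg[OF nn(1)] by (simp add: t_def)
  have s: "sets \<kappa> = sets borel"
    unfolding \<kappa>_def sets_scale_measure borel_prod[symmetric] by (intro sets_pair_measure_cong) simp_all
  have em: "emeasure \<kappa> (A \<times> B) = ennreal (smeasure \<mu> A * smeasure \<rho> B / t)"
    if "A \<in> sets borel" "B \<in> sets borel" for A B
    using that t nn
    by (simp add: \<kappa>_def N.emeasure_pair_measure_Times M.emeasure_eq_measure N.emeasure_eq_measure
        measure_pos_part smeasure_nonneg ennreal_mult[symmetric])
  have m: "measure \<kappa> (A \<times> B) = smeasure \<mu> A * smeasure \<rho> B / t"
    if "A \<in> sets borel" "B \<in> sets borel" for A B
    using em[OF that] t nn by (simp add: measure_def smeasure_nonneg)
  have "space \<kappa> = UNIV" using sets_eq_imp_space_eq[OF s] by simp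
  then have "finite_measure \<kappa>"
    using em[of UNIV UNIV] by (intro finite_measureI) simp
  \<comment> \<open>For \<open>t = 0\<close> the left side is 0 by convention, and monotonicity
    makes the right side 0 as well.\<close>
  moreover have "smeasure \<sigma> A * t / t = smeasure \<sigma> A"
    if "0 \<le> \<sigma>" "smeasure \<sigma> UNIV = t" "A \<in> sets borel" for \<sigma> :: "'a signed_measure" and A
    using smeasure_mono[OF that(1), of A UNIV] smeasure_nonneg[OF that(1), of A] that by (cases "t = 0") auto
  ultimately have "\<kappa> \<in> plans \<mu> \<rho>"
    using s m nn eq by (simp add: plans_def t_def mult.commute)
  then show ?thesis by blast
qed

text \<open>Uniform continuity of \<open>c\<close> on the product of the supports therefore controls
  the cost of a plan.\<close>

lemma plan_supp:
  fixes \<mu> \<rho> :: "'a::second_countable_topology signed_measure"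
  assumes \<pi>: "\<pi> \<in> plans \<mu> \<rho>"
  shows "AE z in \<pi>. fst z \<in> supp \<mu> \<and> snd z \<in> supp \<rho>"
proof -
  have v: "fst -` A = A \<times> (UNIV :: 'a set)" "snd -` A = (UNIV :: 'a set) \<times> A" for A :: "'a set" by auto
  have "AE z in \<pi>. fst z \<in> supp \<mu>" "AE z in \<pi>. snd z \<in> supp \<rho>"
    using \<pi> by (intro AE_supp plan_measurable[OF \<pi>]; simp add: plans_def plan_measurable[OF \<pi>] v)+
  then show ?thesis by eventually_elim simp
qed

theorem theorem8p3:
  fixes \<mu> \<rho> :: "'a::polish_space signed_measure"
    and c :: "'a \<times> 'a \<Rightarrow> real" and \<alpha> p \<epsilon> :: real
  assumes "locally compact (UNIV :: 'a set)"
    and "0 \<le> \<mu>" and "compactly_supported \<mu>"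
    and "0 \<le> \<rho>" and "compactly_supported \<rho>"
    and "norm \<mu> = norm \<rho>"
    and "continuous_on UNIV c" and "\<And>z. 0 \<le> c z"
    and "0 < \<alpha>" and "0 < p" and "\<And>x y. c (x, y) \<le> \<alpha> * dist x y powr p"
    and "0 < \<epsilon>"
  shows "\<exists>\<Phi> :: 'a transfunction. simple_transfunction \<Phi> \<and> markov_transfunction \<Phi> \<and> \<Phi> \<mu> = \<rho> \<and>
    (\<exists>\<kappa>\<in>plans \<mu> \<rho>. is_plan_of \<Phi> \<mu> \<kappa> \<and>
      \<bar>(\<integral>z. c z \<partial>\<kappa>) - (INF \<pi>\<in>plans \<mu> \<rho>. \<integral>z. c z \<partial>\<pi>)\<bar> < \<epsilon>)"
proof -
  let ?I = "INF \<pi>\<in>plans \<mu> \<rho>. \<integral>z. c z \<partial>\<pi>"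
  define t where "t = smeasure \<mu> UNIV"
  have t: "0 \<le> t" using smeasure_nonneg[OF assms(2)] by (simp add: t_def)
  have "plans \<mu> \<rho> \<noteq> {}"
    using plans_nonempty[OF assms(2,4)] assms(6) by (simp add: norm_nonneg_signed_measure assms(2,4))
  moreover have bdd: "bdd_below ((\<lambda>\<pi>. \<integral>z. c z \<partial>\<pi>) ` plans \<mu> \<rho>)"
    using assms(8) by (intro bdd_belowI2[where m = 0]) simp
  \<comment> \<open>A real \<open>INF\<close> is approached by its members only if the set is
    nonempty and bounded below, as just shown.\<close>
  ultimately obtain \<pi> where \<pi>: "\<pi> \<in> plans \<mu> \<rho>" "(\<integral>z. c z \<partial>\<pi>) < ?I + \<epsilon> / 2"
    using assms(12) cINF_less_iff[of "plans \<mu> \<rho>" "\<lambda>\<pi>. \<integral>z. c z \<partial>\<pi>" "?I + \<epsilon> / 2"] by auto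
  \<comment> \<open>This choice gives \<open>t * \<eta> \<le> \<epsilon> / 2\<close>; the summand 1
    keeps the denominator positive when \<open>t = 0\<close>.\<close>
  define \<eta> where "\<eta> = \<epsilon> / (2 * (t + 1))"
  have \<eta>: "0 < \<eta>" using t assms(12) by (simp add: \<eta>_def)
  have comp: "compact (supp \<mu>)" "compact (supp \<rho>)"
    using assms(3,5) by (auto simp: compactly_supported_def)
  have "uniformly_continuous_on (supp \<mu> \<times> supp \<rho>) c"
    using comp assms(7) by (intro compact_uniformly_continuous compact_Times) (auto intro: continuous_on_subset)
  then obtain \<delta> where \<delta>: "0 < \<delta>"
    "\<And>z z'. z \<in> supp \<mu> \<times> supp \<rho> \<Longrightarrow> z' \<in> supp \<mu> \<times> supp \<rho> \<Longrightarrow> dist z' z < \<delta> \<Longrightarrow> dist (c z') (c z) < \<eta>"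
    using \<eta> unfolding uniformly_continuous_on_def by blast
  obtain m :: nat and f :: "nat \<Rightarrow> 'a \<Rightarrow> real" where f: "\<And>i. continuous_on UNIV (f i)" "\<And>i x. 0 \<le> f i x" "\<And>i x. f i x \<le> 1"
    "\<And>x. (\<Sum>i=1..m. f i x) = 1"
    "\<And>i x y. x \<in> supp \<mu> \<Longrightarrow> y \<in> supp \<mu> \<Longrightarrow> f i x \<noteq> 0 \<Longrightarrow> f i y \<noteq> 0 \<Longrightarrow> dist x y < \<delta>"
    by (rule small_partition_of_unity[OF comp(1) \<delta>(1)]) (rule that, assumption+)
  interpret partitioned_plan m f \<mu> \<rho> \<pi>
    by unfold_locales (use f \<pi> in auto)
  have int: "integrable \<kappa> c" if "\<kappa> \<in> plans \<mu> \<rho>" for \<kappa>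
    by (rule plans_integrable[OF that assms(3,5,7)])
  have "(\<integral>\<^sup>+z. ennreal (c z) \<partial>glue) \<le> (\<integral>\<^sup>+z. ennreal (c z + \<eta>) \<partial>\<pi>)"
  proof (rule glue_cost_le[OF borel_measurable_continuous_onI[OF assms(7)] assms(8) _ plan_supp[OF plan]])
    fix x x' y i assume *: "x \<in> supp \<mu>" "x' \<in> supp \<mu>" "y \<in> supp \<rho>" "f i x \<noteq> 0" "f i x' \<noteq> 0"
    \<comment> \<open>Only the first coordinate moves, so the product distance is
      \<open>dist x x'\<close>.\<close>
    then have "dist (x, y) (x', y) < \<delta>" using f(5)[of x x' i] by (simp add: dist_Pair_Pair)
    then have "dist (c (x, y)) (c (x', y)) < \<eta>" using * by (intro \<delta>(2)) auto
    then show "c (x, y) \<le> c (x', y) + \<eta>" by (simp add: dist_real_def)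
  qed (use \<eta> in simp)
  \<comment> \<open>Both plans integrate \<open>c\<close> by compactness of the supports, so no
    default value enters the real integrals.\<close>
  then have "ennreal (\<integral>z. c z \<partial>glue) \<le> ennreal (\<integral>z. c z + \<eta> \<partial>\<pi>)"
    using int[OF glue_plan_of(2)] int[OF plan] assms(8) \<eta>
    by (subst (asm) (1 2) nn_integral_eq_integral) auto
  then have "(\<integral>z. c z \<partial>glue) \<le> (\<integral>z. c z + \<eta> \<partial>\<pi>)"
    using assms(8) \<eta> by (subst (asm) ennreal_le_iff) auto
  \<comment> \<open>The constant contributes \<open>\<eta>\<close> times the mass of
    \<open>\<pi>\<close>, which is \<open>t\<close> by the first marginal.\<close>
  also have "\<dots> = (\<integral>z. c z \<partial>\<pi>) + t * \<eta>"
    using int[OF plan] plan by (simp add: plans_def t_def UNIV_Times_UNIV[symmetric] del: UNIV_Times_UNIV)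
  also have "t * \<eta> \<le> \<epsilon> / 2"
    using t assms(12) by (simp add: \<eta>_def field_simps)
  finally have "(\<integral>z. c z \<partial>glue) < ?I + \<epsilon>" using \<pi>(2) by simp
  moreover have "?I \<le> (\<integral>z. c z \<partial>glue)"
    by (rule cINF_lower[OF bdd glue_plan_of(2)])
  ultimately have "\<bar>(\<integral>z. c z \<partial>glue) - ?I\<bar> < \<epsilon>" by simp
  then show ?thesis
    using transfun_simple_markov transfun_marginal glue_plan_of by blast
qed

end
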